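(* Let $A$ be a non-negative reducible square matrix of order $N$ with no zero row, and let $P_A$ be its row-normalization. Assume that $P_A$ is written in the reduced form $$P_A=\begin{pmatrix} Q_{1,1}&Q_{1,2}&\cdots&Q_{1,L}&Q_{1,L+1}&Q_{1,L+2}&\cdots&Q_{1,L+M}\\ \mathbf{0}&Q_{2,2}&\cdots&Q_{2,L}&Q_{2,L+1}&Q_{2,L+2}&\cdots&Q_{2,L+M}\\ \vdots&\vdots&\ddots&\vdots&\vdots&\vdots&&\vdots\\ \mathbf{0}&\mathbf{0}&\cdots&Q_{L,L}&Q_{L,L+1}&Q_{L,L+2}&\cdots&Q_{L,L+M}\\ \mathbf{0}&\mathbf{0}&\cdots&\mathbf{0}&D_1&\mathbf{0}&\cdots&\mathbf{0}\\ \mathbf{0}&\mathbf{0}&\cdots&\mathbf{0}&\mathbf{0}&D_2&\cdots&\mathbf{0}\\ \vdots&\vdots&&\vdots&\vdots&\vdots&\ddots&\vdots\\ \mathbf{0}&\mathbf{0}&\cdots&\mathbf{0}&\mathbf{0}&\mathbf{0}&\cdots&D_M \end{pmatrix},$$ with $L\ge 1$ and $M\ge 1$, where each diagonal block $Q_{i,i}$ ($i=1,\dots,L$), of order $n_i$, is either irreducible or the null matrix of order $1$ and corresponds to a non-dangling cluster (that is, for each $i\in\{1,\dots,L\}$ at least one of the blocks $Q_{i,j}$ with $i<j\le L+M$ is nonzero), and each $D_j$ ($j=1,\dots,M$), of order $m_j$, is irreducible and corresponds to the $j$-th dangling cluster. Fix $\lambda\in(0,1)$ and let $X(\lambda)=(1-\lambda)(I_N-\lambda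 P_A)^{-1}$. Then for any personalization vector $\mathbf{v}\in\mathbb{R}^{N\times1}$ with $\|\mathbf{v}\|_1=1$, the recursive sequence $\{\mathbf{x}_k\}_{k\ge0}\subset\mathbb{R}^{N\times1}$ with $\mathbf{x}_0=\mathbf{v}$ defined by $$\mathbf{x}_k^T=\mathbf{x}_{k-1}^TX(\lambda)=\mathbf{v}^TX(\lambda)^k,\qquad k\ge1,$$ converges to the vector $$\mathbf{x}^T=\left(\ \mathbf{0}_{n_1\times1}^T\ |\ \mathbf{0}_{n_2\times1}^T\ |\cdots|\ \mathbf{0}_{n_L\times1}^T\ |\ \alpha_1\mathbf{c}_1^T\ |\ \alpha_2\mathbf{c}_2^T\ |\cdots|\ \alpha_M\mathbf{c}_M^T\ \right)$$ for some $\alpha_1,\dots,\alpha_M\ge0$ with $\alpha_1+\cdots+\alpha_M=1$, where $\mathbf{c}_j\in\mathbb{R}^{m_j\times1}$ is the left-hand Perron vector of the row-stochastic irreducible matrix $D_j$, $j=1,\dots,M$.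
   Context: Vectors are column matrices. A vector or matrix is non-negative (positive) if all its entries are $\ge 0$ ($>0$). $\mathbf{e}=(1,\dots,1)^T$ and $\|\mathbf{x}\|_1=\sum_i|x_i|$. A personalization vector is a positive probability vector: $\mathbf{v}>0$ and $\mathbf{v}^T\mathbf{e}=1$. A square matrix $A$ of order $N\ge 2$ is reducible if there is a permutation matrix $R$ such that $R^TAR=\begin{pmatrix}X&Y\\ \mathbf{0}&Z\end{pmatrix}$ with $X,Z$ square (of order at least 1); otherwise it is irreducible. A $1\times1$ matrix is called irreducible when its entry is nonzero. Row-normalization: for a non-negative matrix $A=(a_{ij})$ with no zero row, $P_A=(p_{ij})$ is given by $p_{ij}=a_{ij}/\sum_k a_{ik}$; it is row-stochastic. A dangling cluster is a group of nodes (forming a diagonal block) with no out-links to any other cluster, i.e. all off-diagonal blocks in its block row vanish; a cluster that is not dangling is non-dangling. Left-hand Perron vector: for a non-negative irreducible matrix $M$, the unique vector $\mathbf{q}$ with $\mathbf{q}^TM=\rho(M)\mathbf{q}^T$, $\mathbf{q}>0$, $\mathbf{q}^T\mathbf{e}=1$, where $\rho(M)$ is the spectral radius. *)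

theory Defs
  imports
    Complex_Main
    "HOL-Combinatorics.Permutations"
    "Jordan_Normal_Form.Spectral_Radius"
    "Jordan_Normal_Form.Gauss_Jordan_Elimination"
    "Jordan_Normal_Form.DL_Submatrix"
begin

text \<open>
  Vectors are columns; the row vector \<open>x\<^sup>T\<close> is \<open>mat_of_row x\<close>. All indices, of
  entries as well as of blocks, start at 0.
\<close>

definition nonneg_mat :: "real mat \<Rightarrow> bool" where
  "nonneg_mat A \<longleftrightarrow> (\<forall>i < dim_row A. \<forall>j < dim_col A. A $$ (i, j) \<ge> 0)"

text \<open>The library order \<open><\<close> on vectors is not entrywise strict.\<close>

definition positive_vec :: "real vec \<Rightarrow> bool" where
  "positive_vec v \<longleftrightarrow> (\<forall>i < dim_vec v. v $ i > 0)"

definition ones_vec :: "nat \<Rightarrow> real vec" where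
  "ones_vec n = vec n (\<lambda>_. 1)"

definition norm1 :: "real vec \<Rightarrow> real" where
  "norm1 x = (\<Sum>i < dim_vec x. \<bar>x $ i\<bar>)"

definition vec_tendsto :: "(nat \<Rightarrow> real vec) \<Rightarrow> real vec \<Rightarrow> bool" where
  "vec_tendsto x y \<longleftrightarrow>
     (\<forall>k. dim_vec (x k) = dim_vec y) \<and> (\<lambda>k. norm1 (x k - y)) \<longlonglongrightarrow> 0"

definition personalization_vec :: "nat \<Rightarrow> real vec \<Rightarrow> bool" where
  "personalization_vec n v \<longleftrightarrow>
     v \<in> carrier_vec n \<and> positive_vec v \<and> v \<bullet> ones_vec n = 1"

definition permutation_mat :: "nat \<Rightarrow> real mat \<Rightarrow> bool" where
  "permutation_mat n R \<longleftrightarrow>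
     (\<exists>p. p permutes {..<n} \<and> R = mat n n (\<lambda>(i, j). if i = p j then 1 else 0))"

definition reducible_mat :: "real mat \<Rightarrow> bool" where
  "reducible_mat A \<longleftrightarrow>
     square_mat A \<and> dim_row A \<ge> 2 \<and>
     (\<exists>R X Y Z r s. permutation_mat (dim_row A) R \<and> r \<ge> 1 \<and> s \<ge> 1 \<and> r + s = dim_row A \<and>
        X \<in> carrier_mat r r \<and> Y \<in> carrier_mat r s \<and> Z \<in> carrier_mat s s \<and>
        transpose_mat R * A * R = four_block_mat X Y (0\<^sub>m s r) Z)"

definition irreducible_mat :: "real mat \<Rightarrow> bool" where
  "irreducible_mat A \<longleftrightarrow>
     square_mat A \<and>
     (dim_row A = 1 \<and> A $$ (0, 0) \<noteq> 0 \<or> dim_row A \<ge> 2 \<and> \<not> reducible_mat A)"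

definition row_normalization :: "real mat \<Rightarrow> real mat" where
  "row_normalization A =
     mat (dim_row A) (dim_col A) (\<lambda>(i, j). A $$ (i, j) / (\<Sum>k < dim_col A. A $$ (i, k)))"

definition row_stochastic :: "real mat \<Rightarrow> bool" where
  "row_stochastic A \<longleftrightarrow>
     nonneg_mat A \<and> (\<forall>i < dim_row A. (\<Sum>j < dim_col A. A $$ (i, j)) = 1)"

text \<open>
  \<open>mat_block bs A i j\<close> is the block in position \<open>(i, j)\<close> of the square matrix \<open>A\<close> when its
  rows and its columns are cut into consecutive pieces whose lengths are the entries of \<open>bs\<close>.
\<close>

definition block_indices :: "nat list \<Rightarrow> nat \<Rightarrow> nat set" where
  "block_indices bs i = {sum_list (take i bs) ..< sum_list (take (Suc i) bs)}"

definition mat_block :: "nat list \<Rightarrow> 'a mat \<Rightarrow> nat \<Rightarrow> nat \<Rightarrow> 'a mat" where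
  "mat_block bs A i j = submatrix A (block_indices bs i) (block_indices bs j)"

definition concat_vec :: "'a vec list \<Rightarrow> 'a vec" where
  "concat_vec vs = foldr (@\<^sub>v) vs vNil"

text \<open>
  The spectral radius is taken over the complex eigenvalues, hence the embedding of the real matrix.
\<close>

definition is_left_perron_vec :: "real mat \<Rightarrow> real vec \<Rightarrow> bool" where
  "is_left_perron_vec A q \<longleftrightarrow>
     q \<in> carrier_vec (dim_row A) \<and>
     mat_of_row q * A = spectral_radius (map_mat complex_of_real A) \<cdot>\<^sub>m mat_of_row q \<and>
     positive_vec q \<and> q \<bullet> ones_vec (dim_row A) = 1"

definition left_perron_vec :: "real mat \<Rightarrow> real vec" where
  "left_perron_vec A = (THE q. is_left_perron_vec A q)"

text \<open>
  The inverse exists whenever \<open>P\<close> is row-stochastic and \<open>0 < lam < 1\<close>, so that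
  \<open>mat_inverse\<close> does not return \<open>None\<close> there.
\<close>

definition resolvent_mat :: "real mat \<Rightarrow> real \<Rightarrow> real mat" where
  "resolvent_mat P lam =
     (1 - lam) \<cdot>\<^sub>m the (mat_inverse (1\<^sub>m (dim_row P) - lam \<cdot>\<^sub>m P))"

end

theory Submission
  imports Defs
begin

text \<open>
  The matrix \<open>X = (1 - lam) (I - lam P)\<^sup>-\<^sup>1\<close> is row-stochastic, its entry \<open>(i, j)\<close> is
  positive whenever \<open>j\<close> can be reached from \<open>i\<close> in the graph of \<open>P\<close>, and it
  inherits the closed classes and the invariant vectors of \<open>P\<close>. From every index a dangling
  cluster is reachable: a set of non-dangling indices meets a last block, and either that block is
  left inside itself by irreducibility or it lies in the set and is left by a nonzero block to its
  right. So the mass outside the dangling clusters decays geometrically. On a dangling cluster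
  \<open>X\<close> is positive and stochastic, hence contracts vectors of sum zero in the 1-norm; as the
  inflow dies out, the restriction of \<open>x\<^sub>k\<close> to the cluster converges to a multiple of the
  invariant vector, which is the left Perron vector since the spectral radius is 1.
\<close>

section \<open>Stochastic kernels on finite sets\<close>

text \<open>Two features of P stand in the way of arguing with its powers. A cluster
  \<open>D j\<close> may be periodic, so powers of P need not converge; and a row of a non-dangling
  block may keep all its mass among the non-dangling indices for several steps, so P itself need not
  leak from each row. X cures both at once: its diagonal entries are at least
  \<open>1 - lam\<close>, and one step of X already sees every path of P. All properties of X come
  from two entrywise identities, X = (1 - lam) I + lam P X and X = (1 - lam) I + lam X P, through
  minimum and maximum arguments in a single column. No expansion into a power series is involved.
  Kernels live on index sets rather than on matrices because a closed class is then merely a smaller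
  set: the same lemmas apply to the whole index set and to each cluster, and the shift between local
  and global indices is made only at the interface with the block form.\<close>

definition stochastic_on :: "'a set \<Rightarrow> ('a \<Rightarrow> 'a \<Rightarrow> real) \<Rightarrow> bool" where
  "stochastic_on S p \<longleftrightarrow> (\<forall>i\<in>S. \<forall>j\<in>S. 0 \<le> p i j) \<and> (\<forall>i\<in>S. (\<Sum>j\<in>S. p i j) = 1)"

text \<open>A left fixed vector of the kernel. Neither sign nor normalization is prescribed, so
  differences of such vectors qualify again.\<close>

definition invariant_on :: "'a set \<Rightarrow> ('a \<Rightarrow> 'a \<Rightarrow> real) \<Rightarrow> ('a \<Rightarrow> real) \<Rightarrow> bool" where
  "invariant_on S p w \<longleftrightarrow> (\<forall>j\<in>S. (\<Sum>i\<in>S. w i * p i j) = w j)"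

text \<open>Strong connectivity of the graph of \<open>p\<close>, phrased by cuts. It is vacuous on
  a singleton, whereas \<open>irreducible_mat\<close> asks for a nonzero entry at order 1.\<close>

definition irreducible_on :: "'a set \<Rightarrow> ('a \<Rightarrow> 'a \<Rightarrow> real) \<Rightarrow> bool" where
  "irreducible_on S p \<longleftrightarrow> (\<forall>B. B \<subseteq> S \<longrightarrow> B \<noteq> {} \<longrightarrow> B \<noteq> S \<longrightarrow> (\<exists>i\<in>B. \<exists>j\<in>S - B. p i j \<noteq> 0))"

lemma stochastic_on_nonneg: "stochastic_on S p \<Longrightarrow> i \<in> S \<Longrightarrow> j \<in> S \<Longrightarrow> 0 \<le> p i j"
  by (simp add: stochastic_on_def)

lemma stochastic_on_sum: "stochastic_on S p \<Longrightarrow> i \<in> S \<Longrightarrow> (\<Sum>j\<in>S. p i j) = 1"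
  by (simp add: stochastic_on_def)

lemma stochastic_on_image:
  "inj_on f S \<Longrightarrow> stochastic_on (f ` S) p \<longleftrightarrow> stochastic_on S (\<lambda>a b. p (f a) (f b))"
  by (simp add: stochastic_on_def sum.reindex)

lemma invariant_on_image:
  "inj_on f S \<Longrightarrow> invariant_on (f ` S) p w \<longleftrightarrow> invariant_on S (\<lambda>a b. p (f a) (f b)) (\<lambda>a. w (f a))"
  by (simp add: invariant_on_def sum.reindex)

lemma irreducible_on_image:
  assumes "irreducible_on S (\<lambda>a b. p (f a) (f b))"
  shows "irreducible_on (f ` S) p"
  unfolding irreducible_on_def
proof (intro allI impI)
  fix B assume B: "B \<subseteq> f ` S" "B \<noteq> {}" "B \<noteq> f ` S"
  define B' where "B' = {a \<in> S. f a \<in> B}"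
  have "B' \<subseteq> S" "B' \<noteq> {}" "B' \<noteq> S" using B unfolding B'_def by auto
  with assms obtain a b where "a \<in> B'" "b \<in> S - B'" "p (f a) (f b) \<noteq> 0"
    unfolding irreducible_on_def by meson
  then show "\<exists>i\<in>B. \<exists>j\<in>f ` S - B. p i j \<noteq> 0" unfolding B'_def by auto
qed

lemma irreducible_on_cong:
  assumes irr: "irreducible_on S p" and eq: "\<And>i j. i \<in> S \<Longrightarrow> j \<in> S \<Longrightarrow> p i j = p' i j"
  shows "irreducible_on S p'"
  unfolding irreducible_on_def
proof (intro allI impI)
  fix B assume B: "B \<subseteq> S" "B \<noteq> {}" "B \<noteq> S"
  with irr obtain i j where ij: "i \<in> B" "j \<in> S - B" "p i j \<noteq> 0"
    unfolding irreducible_on_def by meson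
  then have "p' i j \<noteq> 0" using eq[of i j] B by auto
  then show "\<exists>i\<in>B. \<exists>j\<in>S - B. p' i j \<noteq> 0" using ij by blast
qed

lemma stochastic_on_closed:
  assumes S: "finite S" "C \<subseteq> S" and p: "stochastic_on S p"
    and closed: "\<And>i j. i \<in> C \<Longrightarrow> j \<in> S - C \<Longrightarrow> p i j = 0"
  shows "stochastic_on C p"
  unfolding stochastic_on_def
proof (intro conjI ballI)
  fix i assume i: "i \<in> C"
  have "(\<Sum>j\<in>C. p i j) = (\<Sum>j\<in>S. p i j)"
    by (rule sum.mono_neutral_left) (use S closed i in auto)
  then show "(\<Sum>j\<in>C. p i j) = 1" using stochastic_on_sum[OF p, of i] i S by auto
qed (use S stochastic_on_nonneg[OF p] in blast)

lemma stochastic_on_sum_step: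
  assumes "stochastic_on S p"
  shows "(\<Sum>j\<in>S. \<Sum>i\<in>S. w i * p i j) = (\<Sum>i\<in>S. w i)"
proof -
  have "(\<Sum>j\<in>S. \<Sum>i\<in>S. w i * p i j) = (\<Sum>i\<in>S. \<Sum>j\<in>S. w i * p i j)" by (rule sum.swap)
  also have "\<dots> = (\<Sum>i\<in>S. w i)"
    by (rule sum.cong) (simp_all add: stochastic_on_sum[OF assms] flip: sum_distrib_left)
  finally show ?thesis .
qed

text \<open>The triangle inequality bounds each \<bar>w j\<bar> by the mass that \<bar>w\<bar> sends
  to \<open>j\<close>. Both sides have the same total, since a stochastic kernel conserves mass, so
  no entry can be strictly smaller.\<close>

lemma invariant_on_abs:
  assumes S: "finite S" and p: "stochastic_on S p" and w: "invariant_on S p w"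
  shows "invariant_on S p (\<lambda>i. \<bar>w i\<bar>)"
  unfolding invariant_on_def
proof
  have le: "\<bar>w j\<bar> \<le> (\<Sum>i\<in>S. \<bar>w i\<bar> * p i j)" if "j \<in> S" for j
  proof -
    have "\<bar>w j\<bar> = \<bar>\<Sum>i\<in>S. w i * p i j\<bar>" using w that by (simp add: invariant_on_def)
    also have "\<dots> \<le> (\<Sum>i\<in>S. \<bar>w i * p i j\<bar>)" by (rule sum_abs)
    also have "\<dots> = (\<Sum>i\<in>S. \<bar>w i\<bar> * p i j)"
      by (rule sum.cong) (simp_all add: abs_mult stochastic_on_nonneg[OF p] that)
    finally show ?thesis .
  qed
  fix j assume "j \<in> S"
  then show "(\<Sum>i\<in>S. \<bar>w i\<bar> * p i j) = \<bar>w j\<bar>"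
    using sum_mono_inv[of "\<lambda>j. \<bar>w j\<bar>" S "\<lambda>j. \<Sum>i\<in>S. \<bar>w i\<bar> * p i j" j] le S
      stochastic_on_sum_step[OF p, of "\<lambda>i. \<bar>w i\<bar>"] by simp
qed

text \<open>An edge leaving the support of \<open>w\<close> would carry a positive amount into an
  index where \<open>w\<close> vanishes. The support is therefore closed, and irreducibility makes
  it all of \<open>S\<close>.\<close>

lemma invariant_on_pos:
  assumes S: "finite S" and p: "stochastic_on S p" and irr: "irreducible_on S p"
    and w: "invariant_on S p w" and nn: "\<And>i. i \<in> S \<Longrightarrow> 0 \<le> w i"
    and a: "a \<in> S" "w a \<noteq> 0" and j: "j \<in> S"
  shows "0 < w j"
proof (rule ccontr)
  define B where "B = {i \<in> S. 0 < w i}"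
  assume "\<not> 0 < w j"
  then have "B \<subseteq> S" "B \<noteq> {}" "B \<noteq> S" using a j nn[of a] by (auto simp: B_def)
  with irr obtain i l where il: "i \<in> B" "l \<in> S - B" "p i l \<noteq> 0"
    unfolding irreducible_on_def by meson
  then have mem: "i \<in> S" "l \<in> S" "0 < w i" "w l = 0" using nn[of l] by (auto simp: B_def)
  then have "0 < w i * p i l" using il stochastic_on_nonneg[OF p, of i l] by simp
  also have "\<dots> \<le> (\<Sum>i\<in>S. w i * p i l)"
    by (rule member_le_sum) (use mem S nn stochastic_on_nonneg[OF p] in auto)
  also have "\<dots> = w l" using w mem by (simp add: invariant_on_def)
  finally show False using mem by simp
qed

text \<open>For an invariant \<open>d\<close> of sum zero, \<open>\<bar>d\<bar> - d\<close> is invariant and non-negative, hence zero or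
  positive: \<open>d\<close> has constant sign.\<close>

lemma invariant_on_unique:
  assumes S: "finite S" and p: "stochastic_on S p" and irr: "irreducible_on S p"
    and w: "invariant_on S p w" "invariant_on S p u"
    and sums: "(\<Sum>i\<in>S. w i) = (\<Sum>i\<in>S. u i)" and j: "j \<in> S"
  shows "w j = u j"
proof -
  define d where "d = (\<lambda>i. w i - u i)"
  have d: "invariant_on S p d"
    using w by (simp add: invariant_on_def d_def left_diff_distrib sum_subtractf)
  have d0: "(\<Sum>i\<in>S. d i) = 0" using sums by (simp add: d_def sum_subtractf)
  have inv: "invariant_on S p (\<lambda>i. \<bar>d i\<bar> - d i)"
    using d invariant_on_abs[OF S p d] by (simp add: invariant_on_def left_diff_distrib sum_subtractf)
  have "\<bar>d i\<bar> - d i = 0" if i: "i \<in> S" for i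
  proof (rule ccontr)
    assume "\<bar>d i\<bar> - d i \<noteq> 0"
    then have "0 < \<bar>d l\<bar> - d l" if "l \<in> S" for l
      using invariant_on_pos[OF S p irr inv] i that by simp
    then have "d l < 0" if "l \<in> S" for l using that by force
    then have "(\<Sum>i\<in>S. d i) < (\<Sum>i\<in>S. 0)" using S i by (intro sum_strict_mono) auto
    then show False using d0 by simp
  qed
  then have "\<And>i. i \<in> S \<Longrightarrow> 0 \<le> d i" by force
  then have "d j = 0" using d0 S j by (simp add: sum_nonneg_eq_0_iff)
  then show ?thesis by (simp add: d_def)
qed

section \<open>Convergence of a chain with positive closed classes\<close>

text \<open>Doeblin's argument: subtracting a common lower bound of the entries does not change the image
  of a vector of sum zero.\<close>

lemma positive_stochastic_contraction:
  assumes C: "finite C" "C \<noteq> {}" and r: "stochastic_on C r"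
    and pos: "\<And>i j. i \<in> C \<Longrightarrow> j \<in> C \<Longrightarrow> 0 < r i j"
  obtains q where "0 \<le> q" "q < 1"
    "\<And>z. (\<Sum>i\<in>C. z i) = 0 \<Longrightarrow> (\<Sum>j\<in>C. \<bar>\<Sum>i\<in>C. z i * r i j\<bar>) \<le> q * (\<Sum>i\<in>C. \<bar>z i\<bar>)"
proof -
  define e where "e = Min ((\<lambda>(i, j). r i j) ` (C \<times> C))"
  have e_le: "e \<le> r i j" if "i \<in> C" "j \<in> C" for i j
    unfolding e_def by (rule Min_le) (use C that in auto)
  have e_pos: "0 < e" unfolding e_def using C pos by (subst Min_gr_iff) auto
  obtain a where a: "a \<in> C" using C by auto
  have "card C * e = (\<Sum>j\<in>C. e)" by simp
  also have "\<dots> \<le> (\<Sum>j\<in>C. r a j)" by (rule sum_mono) (rule e_le[OF a])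
  also have "\<dots> = 1" using stochastic_on_sum[OF r a] .
  finally have le1: "card C * e \<le> 1" .
  show ?thesis
  \<comment> \<open>Each row of \<open>r i j - e\<close> sums to this constant, which is therefore
    the contraction factor.\<close>
  proof (rule that[of "1 - card C * e"])
    show "0 \<le> 1 - card C * e" using le1 by simp
    show "1 - card C * e < 1" using e_pos C by (simp add: card_gt_0_iff)
    fix z :: "'a \<Rightarrow> real" assume z: "(\<Sum>i\<in>C. z i) = 0"
    have "(\<Sum>j\<in>C. \<bar>\<Sum>i\<in>C. z i * r i j\<bar>) \<le> (\<Sum>j\<in>C. \<Sum>i\<in>C. \<bar>z i\<bar> * (r i j - e))"
    proof (rule sum_mono)
      fix j assume j: "j \<in> C"
      have "(\<Sum>i\<in>C. z i * r i j) = (\<Sum>i\<in>C. z i * (r i j - e))"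
        using z by (simp add: right_diff_distrib sum_subtractf flip: sum_distrib_right)
      also have "\<bar>\<dots>\<bar> \<le> (\<Sum>i\<in>C. \<bar>z i * (r i j - e)\<bar>)" by (rule sum_abs)
      also have "\<dots> = (\<Sum>i\<in>C. \<bar>z i\<bar> * (r i j - e))"
        by (rule sum.cong) (simp_all add: abs_mult e_le j)
      finally show "\<bar>\<Sum>i\<in>C. z i * r i j\<bar> \<le> (\<Sum>i\<in>C. \<bar>z i\<bar> * (r i j - e))" .
    qed
    also have "\<dots> = (\<Sum>i\<in>C. \<Sum>j\<in>C. \<bar>z i\<bar> * (r i j - e))" by (rule sum.swap)
    also have "\<dots> = (\<Sum>i\<in>C. \<bar>z i\<bar> * (1 - card C * e))"
      by (rule sum.cong) (simp_all add: sum_subtractf stochastic_on_sum[OF r] flip: sum_distrib_left)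
    also have "\<dots> = (1 - card C * e) * (\<Sum>i\<in>C. \<bar>z i\<bar>)"
      by (simp add: mult.commute flip: sum_distrib_right)
    finally show "(\<Sum>j\<in>C. \<bar>\<Sum>i\<in>C. z i * r i j\<bar>) \<le> (1 - card C * e) * (\<Sum>i\<in>C. \<bar>z i\<bar>)" .
  qed
qed

lemma uniform_bound_less_1:
  fixes f :: "'a \<Rightarrow> real"
  assumes "finite T" "\<And>i. i \<in> T \<Longrightarrow> f i < 1"
  obtains q where "0 \<le> q" "q < 1" "\<And>i. i \<in> T \<Longrightarrow> f i \<le> q"
  \<comment> \<open>Inserting 0 keeps the maximum defined for empty \<open>T\<close> and makes the
    bound non-negative.\<close>
  by (rule that[of "Max (insert 0 (f ` T))"]) (use assms in auto)

text \<open>\<open>a + K * t\<close> decays geometrically once \<open>K\<close> is large.\<close>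

lemma coupled_contraction_tendsto_0:
  fixes a t :: "nat \<Rightarrow> real"
  assumes nn: "\<And>k. 0 \<le> a k" "\<And>k. 0 \<le> t k"
    and q: "0 \<le> q" "q < 1" and s: "0 \<le> s" "s < 1"
    and a: "\<And>k. a (Suc k) \<le> q * a k + 2 * t k" and t: "\<And>k. t (Suc k) \<le> s * t k"
  shows "a \<longlonglongrightarrow> 0" "t \<longlonglongrightarrow> 0"
proof -
  \<comment> \<open>\<open>K\<close> solves 2 + K s = K (1 + s) / 2: the coupling term 2 is absorbed
    by raising the rate \<open>s\<close> to the midpoint between \<open>s\<close> and 1.\<close>
  define K where "K = 4 / (1 - s)"
  define r where "r = max q ((1 + s) / 2)"
  define W where "W k = a k + K * t k" for k
  have r: "0 \<le> r" "r < 1" "q \<le> r" using q s by (auto simp: r_def)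
  have K: "K > 0" using s by (simp add: K_def)
  have "2 + K * s = K * ((1 + s) / 2)" using s by (simp add: K_def field_simps)
  also have "\<dots> \<le> K * r" by (intro mult_left_mono) (use K in \<open>auto simp: r_def\<close>)
  finally have Kr: "2 + K * s \<le> K * r" .
  have step: "W (Suc k) \<le> r * W k" for k
  proof -
    have "W (Suc k) \<le> q * a k + 2 * t k + K * (s * t k)"
    proof -
      have "K * t (Suc k) \<le> K * (s * t k)" using t K by (intro mult_left_mono) auto
      then show ?thesis unfolding W_def using a[of k] by linarith
    qed
    also have "\<dots> = q * a k + (2 + K * s) * t k" by (simp add: algebra_simps)
    also have "\<dots> \<le> r * a k + (K * r) * t k"
      by (intro add_mono mult_right_mono r Kr nn)
    finally show ?thesis by (simp add: W_def algebra_simps)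
  qed
  have bound: "W k \<le> r ^ k * W 0" for k
  proof (induction k)
    case (Suc k)
    have "W (Suc k) \<le> r * W k" by (rule step)
    also have "\<dots> \<le> r * (r ^ k * W 0)" using Suc r by (intro mult_left_mono)
    finally show ?case by (simp add: mult.assoc)
  qed simp
  have W0: "(\<lambda>k. r ^ k * W 0) \<longlonglongrightarrow> 0"
    by (rule tendsto_mult_left_zero) (use r in \<open>simp add: LIMSEQ_realpow_zero\<close>)
  have W: "W \<longlonglongrightarrow> 0"
    by (rule tendsto_sandwich[OF _ _ tendsto_const W0])
      (use bound nn K in \<open>auto simp: W_def\<close>)
  show "a \<longlonglongrightarrow> 0"
    by (rule tendsto_sandwich[OF _ _ tendsto_const W]) (use nn K in \<open>auto simp: W_def\<close>)
  have WK: "(\<lambda>k. W k / K) \<longlonglongrightarrow> 0" using tendsto_divide_zero[OF W] .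
  show "t \<longlonglongrightarrow> 0"
    by (rule tendsto_sandwich[OF _ _ tendsto_const WK]) (use nn K in \<open>auto simp: W_def field_simps\<close>)
qed

section \<open>Mass flow from a transient set into closed classes\<close>

lemma chain_nonneg_sum:
  assumes r: "stochastic_on S r"
    and x: "\<And>k j. j \<in> S \<Longrightarrow> x (Suc k) j = (\<Sum>i\<in>S. x k i * r i j)"
    and x0: "\<And>i. i \<in> S \<Longrightarrow> 0 \<le> x 0 i"
  shows "i \<in> S \<Longrightarrow> 0 \<le> x k i" "(\<Sum>i\<in>S. x k i) = (\<Sum>i\<in>S. x 0 i)"
proof -
  show "i \<in> S \<Longrightarrow> 0 \<le> x k i"
  proof (induction k arbitrary: i)
    case (Suc k)
    then show ?case by (auto simp: x stochastic_on_nonneg[OF r] intro!: sum_nonneg)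
  qed (use x0 in auto)
  show "(\<Sum>i\<in>S. x k i) = (\<Sum>i\<in>S. x 0 i)"
    by (induction k) (simp_all add: x stochastic_on_sum_step[OF r])
qed

text \<open>Nothing enters \<open>T\<close>, and each of its finitely many rows keeps less than its
  full mass inside \<open>T\<close>; \<open>s\<close> bounds all the fractions kept.\<close>

lemma chain_transient_decay:
  assumes S: "finite S" "T \<subseteq> S" and r: "stochastic_on S r"
    and no_return: "\<And>i j. i \<in> S - T \<Longrightarrow> j \<in> T \<Longrightarrow> r i j = 0"
    and leak: "\<And>i. i \<in> T \<Longrightarrow> \<exists>j\<in>S - T. r i j \<noteq> 0"
    and x: "\<And>k j. j \<in> S \<Longrightarrow> x (Suc k) j = (\<Sum>i\<in>S. x k i * r i j)"
    and x0: "\<And>i. i \<in> S \<Longrightarrow> 0 \<le> x 0 i"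
  obtains s where "0 \<le> s" "s < 1" "\<And>k. (\<Sum>j\<in>T. x (Suc k) j) \<le> s * (\<Sum>j\<in>T. x k j)"
proof -
  note xnn = chain_nonneg_sum(1)[of S r x, OF r x x0]
  have finT: "finite T" using S finite_subset by auto
  have "(\<Sum>j\<in>T. r i j) < 1" if i: "i \<in> T" for i
  proof -
    have "0 < (\<Sum>j\<in>S - T. r i j)"
    proof -
      obtain j where j: "j \<in> S - T" "r i j \<noteq> 0" using leak[OF i] by blast
      have nn: "0 \<le> r i l" if "l \<in> S - T" for l
        using stochastic_on_nonneg[OF r, of i l] S(2) i that by auto
      have "0 < r i j" using nn[OF j(1)] j(2) by simp
      then show ?thesis by (rule sum_pos2[rotated 2]) (use S(1) j nn in auto)
    qed
    then show ?thesis
      using sum.subset_diff[OF S(2,1), of "r i"] stochastic_on_sum[OF r, of i] S i by auto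
  qed
  then obtain s where s: "0 \<le> s" "s < 1" "\<And>i. i \<in> T \<Longrightarrow> (\<Sum>j\<in>T. r i j) \<le> s"
    using uniform_bound_less_1[OF finT, of "\<lambda>i. \<Sum>j\<in>T. r i j"] by auto
  show ?thesis
  proof (rule that[OF s(1,2)])
    fix k
    have "(\<Sum>j\<in>T. x (Suc k) j) = (\<Sum>j\<in>T. \<Sum>i\<in>T. x k i * r i j)"
    proof (rule sum.cong[OF refl])
      fix j assume j: "j \<in> T"
      have "x (Suc k) j = (\<Sum>i\<in>S. x k i * r i j)" using x j S by auto
      also have "\<dots> = (\<Sum>i\<in>T. x k i * r i j)"
        by (rule sum.mono_neutral_right) (use S no_return j in auto)
      finally show "x (Suc k) j = (\<Sum>i\<in>T. x k i * r i j)" .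
    qed
    also have "\<dots> = (\<Sum>i\<in>T. \<Sum>j\<in>T. x k i * r i j)" by (rule sum.swap)
    also have "\<dots> \<le> (\<Sum>i\<in>T. x k i * s)"
      using s(3) xnn S by (auto simp flip: sum_distrib_left intro!: sum_mono mult_left_mono)
    also have "\<dots> = s * (\<Sum>j\<in>T. x k j)" by (simp add: mult.commute flip: sum_distrib_left)
    finally show "(\<Sum>j\<in>T. x (Suc k) j) \<le> s * (\<Sum>j\<in>T. x k j)" .
  qed
qed

lemma chain_transient_tendsto_0:
  assumes S: "finite S" "T \<subseteq> S" and r: "stochastic_on S r"
    and no_return: "\<And>i j. i \<in> S - T \<Longrightarrow> j \<in> T \<Longrightarrow> r i j = 0"
    and leak: "\<And>i. i \<in> T \<Longrightarrow> \<exists>j\<in>S - T. r i j \<noteq> 0"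
    and x: "\<And>k j. j \<in> S \<Longrightarrow> x (Suc k) j = (\<Sum>i\<in>S. x k i * r i j)"
    and x0: "\<And>i. i \<in> S \<Longrightarrow> 0 \<le> x 0 i"
    and j: "j \<in> T"
  shows "(\<lambda>k. x k j) \<longlonglongrightarrow> 0"
proof -
  note xnn = chain_nonneg_sum(1)[of S r x, OF r x x0]
  define t where "t k = (\<Sum>j\<in>T. x k j)" for k
  have t_nn: "0 \<le> t k" for k unfolding t_def using S xnn by (intro sum_nonneg) auto
  obtain s where s: "0 \<le> s" "s < 1" "\<And>k. t (Suc k) \<le> s * t k"
    unfolding t_def using chain_transient_decay[of S T r x, OF S r no_return leak x x0] by blast
  \<comment> \<open>With the first sequence and its rate set to 0, the coupled estimate reduces to
    the decay of \<open>t\<close> alone.\<close>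
  have t0: "t \<longlonglongrightarrow> 0"
    by (rule coupled_contraction_tendsto_0(2)[of "\<lambda>_. 0" t 0 s]) (use s t_nn in auto)
  have "x k j \<le> t k" for k
    unfolding t_def by (rule member_le_sum[of j]) (use j S xnn finite_subset[of T S] in auto)
  moreover have "0 \<le> x k j" for k using xnn j S by auto
  ultimately show ?thesis by (intro tendsto_sandwich[OF _ _ tendsto_const t0]) auto
qed

text \<open>The mass \<open>m k\<close> of the closed class \<open>C\<close> increases; the deviation of \<open>x k\<close> from
  \<open>m k\<close> times the invariant vector is contracted up to the inflow from \<open>T\<close>, which dies out.\<close>

lemma chain_closed_class_limit:
  assumes S: "finite S" "T \<subseteq> S" "C \<subseteq> S - T" "C \<noteq> {}" and r: "stochastic_on S r"
    and no_return: "\<And>i j. i \<in> S - T \<Longrightarrow> j \<in> T \<Longrightarrow> r i j = 0"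
    and leak: "\<And>i. i \<in> T \<Longrightarrow> \<exists>j\<in>S - T. r i j \<noteq> 0"
    and rC: "stochastic_on C r" and pos: "\<And>i j. i \<in> C \<Longrightarrow> j \<in> C \<Longrightarrow> 0 < r i j"
    and inflow: "\<And>i j. i \<in> S - C - T \<Longrightarrow> j \<in> C \<Longrightarrow> r i j = 0"
    and c: "invariant_on C r c" "\<And>i. i \<in> C \<Longrightarrow> 0 \<le> c i" "(\<Sum>i\<in>C. c i) = 1"
    and x: "\<And>k j. j \<in> S \<Longrightarrow> x (Suc k) j = (\<Sum>i\<in>S. x k i * r i j)"
    and x0: "\<And>i. i \<in> S \<Longrightarrow> 0 \<le> x 0 i"
  obtains \<alpha> where "0 \<le> \<alpha>" "\<And>j. j \<in> C \<Longrightarrow> (\<lambda>k. x k j) \<longlonglongrightarrow> \<alpha> * c j"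
proof -
  note xnn = chain_nonneg_sum(1)[of S r x, OF r x x0]
  note xsum = chain_nonneg_sum(2)[of S r x, OF r x x0]
  have fin: "finite C" "finite T" using finite_subset[OF S(3)] finite_subset[OF S(2,1)] S(1) by simp_all
  define m where "m k = (\<Sum>j\<in>C. x k j)" for k
  define t where "t k = (\<Sum>j\<in>T. x k j)" for k
  define b where "b k j = (\<Sum>i\<in>T. x k i * r i j)" for k j
  define z where "z k j = x k j - m k * c j" for k j
  define a where "a k = (\<Sum>j\<in>C. \<bar>z k j\<bar>)" for k
  obtain s where s: "0 \<le> s" "s < 1" "\<And>k. t (Suc k) \<le> s * t k"
    unfolding t_def using chain_transient_decay[of S T r x, OF S(1,2) r no_return leak x x0] by blast
  obtain q where q: "0 \<le> q" "q < 1"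
    "\<And>z. (\<Sum>i\<in>C. z i) = 0 \<Longrightarrow> (\<Sum>j\<in>C. \<bar>\<Sum>i\<in>C. z i * r i j\<bar>) \<le> q * (\<Sum>i\<in>C. \<bar>z i\<bar>)"
    using positive_stochastic_contraction[OF fin(1) S(4) rC pos] by blast
  have b_nn: "0 \<le> b k j" if "j \<in> C" for k j
    unfolding b_def using that S
    by (intro sum_nonneg mult_nonneg_nonneg xnn stochastic_on_nonneg[OF r]) auto
  have b_sum: "(\<Sum>j\<in>C. b k j) \<le> t k" for k
  proof -
    have "(\<Sum>j\<in>C. b k j) = (\<Sum>i\<in>T. x k i * (\<Sum>j\<in>C. r i j))"
      unfolding b_def sum_distrib_left by (rule sum.swap)
    also have "\<dots> \<le> (\<Sum>i\<in>T. x k i * 1)"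
    proof (intro sum_mono mult_left_mono)
      fix i assume i: "i \<in> T"
      then show "0 \<le> x k i" using xnn S by auto
      have "(\<Sum>j\<in>C. r i j) \<le> (\<Sum>j\<in>S. r i j)"
        by (rule sum_mono2) (use S i stochastic_on_nonneg[OF r] in auto)
      then show "(\<Sum>j\<in>C. r i j) \<le> 1" using stochastic_on_sum[OF r, of i] S i by auto
    qed
    finally show ?thesis by (simp add: t_def)
  qed
  have xC: "x (Suc k) j = (\<Sum>i\<in>C. x k i * r i j) + b k j" if j: "j \<in> C" for k j
  proof -
    have "x (Suc k) j = (\<Sum>i\<in>S. x k i * r i j)" using x j S by auto
    also have "\<dots> = (\<Sum>i\<in>C \<union> T. x k i * r i j)"
      by (rule sum.mono_neutral_right) (use S inflow j in auto)
    also have "\<dots> = (\<Sum>i\<in>C. x k i * r i j) + b k j"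
      unfolding b_def by (rule sum.union_disjoint) (use S fin in auto)
    finally show ?thesis .
  qed
  have m_Suc: "m (Suc k) = m k + (\<Sum>j\<in>C. b k j)" for k
    by (simp add: m_def xC sum.distrib stochastic_on_sum_step[OF rC])
  have zsum: "(\<Sum>j\<in>C. z k j) = 0" for k
    by (simp add: z_def sum_subtractf c m_def flip: sum_distrib_left)
  \<comment> \<open>The part \<open>m k * c\<close> is reproduced by the step. The inflow
    \<open>b\<close> enters with its total times \<open>c\<close> removed, which keeps the sum of
    \<open>z\<close> at 0.\<close>
  have z_Suc: "z (Suc k) j = (\<Sum>i\<in>C. z k i * r i j) + (b k j - (\<Sum>l\<in>C. b k l) * c j)"
    if j: "j \<in> C" for k j
  proof -
    have "(\<Sum>i\<in>C. z k i * r i j) = (\<Sum>i\<in>C. x k i * r i j) - m k * (\<Sum>i\<in>C. c i * r i j)"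
      by (simp add: z_def left_diff_distrib sum_subtractf sum_distrib_left mult.assoc)
    also have "(\<Sum>i\<in>C. c i * r i j) = c j" using c j by (simp add: invariant_on_def)
    finally show ?thesis using j by (simp add: z_def xC m_Suc algebra_simps)
  qed
  \<comment> \<open>The inflow counts twice: once as \<open>b\<close> itself and once as its total
    times \<open>c\<close>, whose sum over \<open>C\<close> is 1.\<close>
  have a_Suc: "a (Suc k) \<le> q * a k + 2 * t k" for k
  proof -
    have bs: "0 \<le> (\<Sum>l\<in>C. b k l)" by (intro sum_nonneg b_nn)
    have "a (Suc k) \<le> (\<Sum>j\<in>C. \<bar>\<Sum>i\<in>C. z k i * r i j\<bar> + (b k j + (\<Sum>l\<in>C. b k l) * c j))"
      unfolding a_def
    proof (rule sum_mono)
      fix j assume j: "j \<in> C"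
      have "0 \<le> (\<Sum>l\<in>C. b k l) * c j" using bs c j by simp
      then show "\<bar>z (Suc k) j\<bar> \<le> \<bar>\<Sum>i\<in>C. z k i * r i j\<bar> + (b k j + (\<Sum>l\<in>C. b k l) * c j)"
        unfolding z_Suc[OF j] using b_nn[OF j, of k] by linarith
    qed
    also have "\<dots> = (\<Sum>j\<in>C. \<bar>\<Sum>i\<in>C. z k i * r i j\<bar>) + 2 * (\<Sum>l\<in>C. b k l)"
      by (simp add: sum.distrib c flip: sum_distrib_left)
    also have "\<dots> \<le> q * a k + 2 * t k"
      unfolding a_def using q(3)[of "z k", OF zsum] b_sum[of k] by linarith
    finally show ?thesis .
  qed
  have a0: "a \<longlonglongrightarrow> 0"
  proof (rule coupled_contraction_tendsto_0(1)[of a t q s])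
    show "0 \<le> t k" for k unfolding t_def using S xnn by (intro sum_nonneg) auto
  qed (use q s a_Suc in \<open>auto simp: a_def intro: sum_nonneg\<close>)
  have "incseq m"
    by (rule incseq_SucI) (use b_nn in \<open>simp add: m_Suc sum_nonneg\<close>)
  moreover have "m k \<le> (\<Sum>i\<in>S. x 0 i)" for k
  proof -
    have "m k \<le> (\<Sum>i\<in>S. x k i)" unfolding m_def by (rule sum_mono2) (use S xnn in auto)
    then show ?thesis using xsum[of k] by simp
  qed
  ultimately obtain \<alpha> where \<alpha>: "m \<longlonglongrightarrow> \<alpha>" by (meson incseq_convergent)
  show ?thesis
  proof (rule that[of \<alpha>])
    have "0 \<le> m k" for k unfolding m_def using S xnn by (intro sum_nonneg) auto
    then show "0 \<le> \<alpha>" using \<alpha> by (intro LIMSEQ_le_const[OF \<alpha>]) auto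
    fix j assume j: "j \<in> C"
    have "\<bar>z k j\<bar> \<le> a k" for k
      unfolding a_def by (rule member_le_sum[of j]) (use fin j in auto)
    then have "(\<lambda>k. \<bar>z k j\<bar>) \<longlonglongrightarrow> 0"
      by (intro tendsto_sandwich[OF _ _ tendsto_const a0]) auto
    then have "(\<lambda>k. z k j) \<longlonglongrightarrow> 0" by (simp add: tendsto_rabs_zero_iff)
    then have "(\<lambda>k. z k j + m k * c j) \<longlonglongrightarrow> 0 + \<alpha> * c j" by (intro tendsto_intros \<alpha>)
    then show "(\<lambda>k. x k j) \<longlonglongrightarrow> \<alpha> * c j" by (simp add: z_def)
  qed
qed

section \<open>Resolvents of stochastic kernels\<close>

text \<open>The two sides of the inverse relation for I - lam P, scaled by \<open>1 - lam\<close>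
  and written entrywise, so that the notion can be restricted to a subset of indices. The first
  identity relates entries within a column of \<open>r\<close>, the second within a row.\<close>

definition resolvent_on :: "'a set \<Rightarrow> ('a \<Rightarrow> 'a \<Rightarrow> real) \<Rightarrow> real \<Rightarrow> ('a \<Rightarrow> 'a \<Rightarrow> real) \<Rightarrow> bool" where
  "resolvent_on S p lam r \<longleftrightarrow> (\<forall>i\<in>S. \<forall>j\<in>S.
     r i j = (1 - lam) * of_bool (i = j) + lam * (\<Sum>k\<in>S. p i k * r k j) \<and>
     r i j = (1 - lam) * of_bool (i = j) + lam * (\<Sum>k\<in>S. r i k * p k j))"

context
  fixes S :: "'a set" and p r :: "'a \<Rightarrow> 'a \<Rightarrow> real" and lam :: real
  assumes S: "finite S" and p: "stochastic_on S p" and lam: "0 < lam" "lam < 1"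
    and r: "resolvent_on S p lam r"
begin

lemma resolvent_left:
  "i \<in> S \<Longrightarrow> j \<in> S \<Longrightarrow> r i j = (1 - lam) * of_bool (i = j) + lam * (\<Sum>k\<in>S. p i k * r k j)"
  using r unfolding resolvent_on_def by blast

lemma resolvent_right:
  "i \<in> S \<Longrightarrow> j \<in> S \<Longrightarrow> r i j = (1 - lam) * of_bool (i = j) + lam * (\<Sum>k\<in>S. r i k * p k j)"
  using r unfolding resolvent_on_def by blast

text \<open>Compare with the smallest entry of a column.\<close>

lemma resolvent_nonneg:
  assumes i: "i \<in> S" and j: "j \<in> S"
  shows "0 \<le> r i j"
proof -
  define m where "m = Min ((\<lambda>i. r i j) ` S)"
  have m_le: "m \<le> r k j" if "k \<in> S" for k unfolding m_def using S that by auto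
  have "m \<in> (\<lambda>i. r i j) ` S" unfolding m_def using S i by (intro Min_in) auto
  then obtain a where a: "a \<in> S" "r a j = m" by auto
  \<comment> \<open>Row \<open>a\<close> of \<open>p\<close> averages column \<open>j\<close>, hence
    cannot fall below its minimum \<open>m\<close>; this yields lam m \<le> m.\<close>
  have "lam * m = lam * (\<Sum>k\<in>S. p a k * m)"
    using stochastic_on_sum[OF p a(1)] by (simp flip: sum_distrib_right)
  also have "\<dots> \<le> lam * (\<Sum>k\<in>S. p a k * r k j)"
    using lam a m_le stochastic_on_nonneg[OF p] by (intro mult_left_mono sum_mono) auto
  also have "\<dots> \<le> m" using resolvent_left[OF a(1) j] a lam by simp
  finally have "0 \<le> (1 - lam) * m" by (simp add: algebra_simps)
  then have "0 \<le> m" using lam by (simp add: zero_le_mult_iff)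
  then show ?thesis using m_le[OF i] by simp
qed

text \<open>Summed over \<open>j\<close>, the right identity closes into s = (1 - lam) + lam s for
  the sum s of a single row. The left identity would couple different row sums.\<close>

lemma resolvent_stochastic: "stochastic_on S r"
  unfolding stochastic_on_def
proof (intro conjI ballI)
  fix i assume i: "i \<in> S"
  have "(\<Sum>j\<in>S. r i j) = (\<Sum>j\<in>S. (1 - lam) * of_bool (i = j) + lam * (\<Sum>k\<in>S. r i k * p k j))"
    by (rule sum.cong[OF refl], rule resolvent_right[OF i])
  also have "\<dots> = (1 - lam) * (\<Sum>j\<in>S. of_bool (i = j)) + lam * (\<Sum>j\<in>S. \<Sum>k\<in>S. r i k * p k j)"
    by (simp only: sum.distrib sum_distrib_left)
  also have "\<dots> = (1 - lam) + lam * (\<Sum>j\<in>S. r i j)"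
    using S i by (simp add: stochastic_on_sum_step[OF p] of_bool_def)
  finally have "(1 - lam) * ((\<Sum>j\<in>S. r i j) - 1) = 0" by (simp add: algebra_simps)
  then show "(\<Sum>j\<in>S. r i j) = 1" using lam by simp
qed (rule resolvent_nonneg)

text \<open>The diagonal entry is at least \<open>1 - lam\<close>: staying put always has positive
  weight, which removes any periodicity of \<open>p\<close>.\<close>

lemma resolvent_diag_pos: "i \<in> S \<Longrightarrow> 0 < r i i"
  using lam resolvent_left[of i i]
  by (simp add: add_pos_nonneg sum_nonneg stochastic_on_nonneg[OF p] resolvent_nonneg)

text \<open>Positivity in column \<open>j\<close> travels backwards along edges of \<open>p\<close>;
  started at the diagonal it covers every index from which \<open>j\<close> is reachable.\<close>

lemma resolvent_pos_step:
  assumes "i \<in> S" "k \<in> S" "j \<in> S" "p i k \<noteq> 0" "0 < r k j"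
  shows "0 < r i j"
proof -
  have "0 < lam * (p i k * r k j)"
    using assms lam stochastic_on_nonneg[OF p, of i k] by simp
  also have "\<dots> \<le> lam * (\<Sum>k\<in>S. p i k * r k j)"
    using assms lam S by (intro mult_left_mono member_le_sum)
      (auto intro!: mult_nonneg_nonneg stochastic_on_nonneg[OF p] resolvent_nonneg)
  also have "\<dots> \<le> r i j" using resolvent_left[of i j] assms lam by simp
  finally show ?thesis .
qed

text \<open>A nonempty set of zeros in column \<open>j\<close> misses \<open>j\<close>, so
  irreducibility gives an edge out of it. Its end carries a positive value, which propagates back to
  its start.\<close>

lemma resolvent_pos:
  assumes irr: "irreducible_on S p" and i: "i \<in> S" and j: "j \<in> S"
  shows "0 < r i j"
proof (rule ccontr)
  define B where "B = {i \<in> S. r i j = 0}"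
  assume "\<not> 0 < r i j"
  then have "i \<in> B" "j \<notin> B" "B \<subseteq> S"
    using i j resolvent_nonneg[of i j] resolvent_diag_pos[of j] by (auto simp: B_def)
  then have "B \<subseteq> S" "B \<noteq> {}" "B \<noteq> S" using j by auto
  with irr obtain a k where ak: "a \<in> B" "k \<in> S - B" "p a k \<noteq> 0"
    unfolding irreducible_on_def by meson
  then have "0 < r k j" using resolvent_nonneg[of k j] j by (auto simp: B_def)
  then show False using resolvent_pos_step[of a k j] ak j by (auto simp: B_def)
qed

text \<open>Maximum principle in column \<open>j\<close>: on \<open>C\<close> the identity term
  vanishes and closedness confines the average to \<open>C\<close>, so the maximum \<open>m\<close>
  over \<open>C\<close> satisfies m \<le> lam m.\<close>

lemma resolvent_closed_zero:
  assumes C: "C \<subseteq> S" and closed: "\<And>i j. i \<in> C \<Longrightarrow> j \<in> S - C \<Longrightarrow> p i j = 0"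
    and i: "i \<in> C" and j: "j \<in> S - C"
  shows "r i j = 0"
proof -
  have finC: "finite C" using C S finite_subset by auto
  define m where "m = Max ((\<lambda>i. r i j) ` C)"
  have le_m: "r k j \<le> m" if "k \<in> C" for k unfolding m_def using finC that by auto
  have "m \<in> (\<lambda>i. r i j) ` C" unfolding m_def using finC i by (intro Max_in) auto
  then obtain a where a: "a \<in> C" "r a j = m" by auto
  have "m = lam * (\<Sum>k\<in>S. p a k * r k j)"
    using resolvent_left[of a j] a j C by auto
  also have "\<dots> = lam * (\<Sum>k\<in>C. p a k * r k j)"
    by (intro arg_cong[where f = "(*) lam"] sum.mono_neutral_right) (use S C closed a in auto)
  also have "\<dots> \<le> lam * (\<Sum>k\<in>C. p a k * m)"
    using lam a le_m subsetD[OF C] stochastic_on_nonneg[OF p] by (intro mult_left_mono sum_mono) auto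
  also have "(\<Sum>k\<in>C. p a k * m) = (\<Sum>k\<in>S. p a k) * m"
    unfolding sum_distrib_right by (rule sum.mono_neutral_left) (use S C closed a in auto)
  also have "\<dots> = m" using stochastic_on_sum[OF p, of a] a C by auto
  finally have "(1 - lam) * m \<le> 0" by (simp add: algebra_simps)
  then have "m \<le> 0" using lam by (simp add: mult_le_0_iff)
  then show ?thesis using le_m[OF i] resolvent_nonneg[of i j] i j C by force
qed

text \<open>From the left identity, w X = (1 - lam) w + lam w P X = (1 - lam) w + lam w X, which
  forces w X = w because lam < 1.\<close>

lemma resolvent_invariant:
  assumes w: "invariant_on S p w"
  shows "invariant_on S r w"
  unfolding invariant_on_def
proof
  fix j assume j: "j \<in> S"
  have "(\<Sum>i\<in>S. w i * r i j) =
      (\<Sum>i\<in>S. w i * ((1 - lam) * of_bool (i = j)) + lam * (\<Sum>k\<in>S. w i * p i k * r k j))"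
  proof (rule sum.cong[OF refl])
    fix i assume "i \<in> S"
    then have "w i * r i j = w i * ((1 - lam) * of_bool (i = j) + lam * (\<Sum>k\<in>S. p i k * r k j))"
      using resolvent_left[of i j] j by simp
    then show "w i * r i j = w i * ((1 - lam) * of_bool (i = j)) + lam * (\<Sum>k\<in>S. w i * p i k * r k j)"
      by (simp add: distrib_left sum_distrib_left mult_ac)
  qed
  also have "\<dots> = (\<Sum>i\<in>S. w i * ((1 - lam) * of_bool (i = j))) +
      lam * (\<Sum>i\<in>S. \<Sum>k\<in>S. w i * p i k * r k j)"
    by (simp only: sum.distrib sum_distrib_left)
  also have "(\<Sum>i\<in>S. w i * ((1 - lam) * of_bool (i = j))) = (1 - lam) * w j"
    using S j by (simp add: of_bool_def if_distrib cong: if_cong)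
  also have "(\<Sum>i\<in>S. \<Sum>k\<in>S. w i * p i k * r k j) = (\<Sum>k\<in>S. \<Sum>i\<in>S. w i * p i k * r k j)"
    by (rule sum.swap)
  also have "\<dots> = (\<Sum>k\<in>S. w k * r k j)"
    by (rule sum.cong) (use w in \<open>simp_all add: invariant_on_def flip: sum_distrib_right\<close>)
  finally have "(1 - lam) * ((\<Sum>i\<in>S. w i * r i j) - w j) = 0" by (simp add: algebra_simps)
  then show "(\<Sum>i\<in>S. w i * r i j) = w j" using lam by simp
qed

text \<open>The left identity restricts because \<open>p\<close> has no entries leading out of
  \<open>C\<close>, the right one because \<open>r\<close> has none either. Each dangling cluster
  thereby becomes a chain of its own with its own resolvent.\<close>

lemma resolvent_on_closed:
  assumes C: "C \<subseteq> S" and closed: "\<And>i j. i \<in> C \<Longrightarrow> j \<in> S - C \<Longrightarrow> p i j = 0"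
  shows "resolvent_on C p lam r"
  unfolding resolvent_on_def
proof (intro ballI conjI)
  fix i j assume i: "i \<in> C" and j: "j \<in> C"
  then have ij: "i \<in> S" "j \<in> S" using C by auto
  have "(\<Sum>k\<in>S. p i k * r k j) = (\<Sum>k\<in>C. p i k * r k j)"
    by (rule sum.mono_neutral_right) (use S C closed i in auto)
  then show "r i j = (1 - lam) * of_bool (i = j) + lam * (\<Sum>k\<in>C. p i k * r k j)"
    using resolvent_left[OF ij] by simp
  have "(\<Sum>k\<in>S. r i k * p k j) = (\<Sum>k\<in>C. r i k * p k j)"
    by (rule sum.mono_neutral_right) (use S C i resolvent_closed_zero[OF C closed] in auto)
  then show "r i j = (1 - lam) * of_bool (i = j) + lam * (\<Sum>k\<in>C. r i k * p k j)"
    using resolvent_right[OF ij] by simp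
qed

text \<open>Let \<open>E\<close> collect the rows of \<open>T\<close> that do not leak. Its exit
  edge ends outside \<open>T\<close>, where the diagonal is positive, or at a row of
  \<open>T\<close> that does leak; pulling positivity back along the edge makes its start leak as
  well.\<close>

lemma resolvent_leak:
  assumes T: "T \<subseteq> S" and exit: "\<And>E. E \<subseteq> T \<Longrightarrow> E \<noteq> {} \<Longrightarrow> \<exists>i\<in>E. \<exists>k\<in>S - E. p i k \<noteq> 0"
    and i: "i \<in> T"
  shows "\<exists>j\<in>S - T. r i j \<noteq> 0"
proof (rule ccontr)
  define E where "E = {i \<in> T. \<forall>j\<in>S - T. r i j = 0}"
  assume "\<not> ?thesis"
  then have "E \<subseteq> T" "E \<noteq> {}" using i by (auto simp: E_def)
  then obtain a k where ak: "a \<in> E" "k \<in> S - E" "p a k \<noteq> 0" using exit by meson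
  have "\<exists>j\<in>S - T. r k j \<noteq> 0"
  proof (cases "k \<in> T")
    case False
    then show ?thesis using resolvent_diag_pos[of k] ak by force
  qed (use ak in \<open>auto simp: E_def\<close>)
  then obtain j where j: "j \<in> S - T" "r k j \<noteq> 0" by blast
  then have "0 < r k j" using resolvent_nonneg[of k j] ak by simp
  then have "0 < r a j" using resolvent_pos_step[of a k j] ak j T by (auto simp: E_def)
  then show False using ak j by (auto simp: E_def)
qed

end

section \<open>Block decompositions and irreducible matrices\<close>

lemma pick_interval:
  assumes "n < b - a"
  shows "pick {a..<b} n = a + n"
proof -
  have "{x \<in> {a..<b}. x < a + n} = {a..<a + n}" using assms by auto
  then show ?thesis using pick_card_in_set[of "a + n" "{a..<b}"] assms by simp
qed

abbreviation block_offset :: "nat list \<Rightarrow> nat \<Rightarrow> nat" where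
  "block_offset bs i \<equiv> sum_list (take i bs)"

lemma block_indices_eq:
  "i < length bs \<Longrightarrow> block_indices bs i = {block_offset bs i..<block_offset bs i + bs ! i}"
  by (simp add: block_indices_def take_Suc_conv_app_nth)

lemma block_indices_image:
  "i < length bs \<Longrightarrow> block_indices bs i = (\<lambda>a. block_offset bs i + a) ` {..<bs ! i}"
  by (simp add: block_indices_eq lessThan_atLeast0 image_add_atLeastLessThan add.commute)

lemma block_offset_mono:
  assumes "i \<le> j" shows "block_offset bs i \<le> block_offset bs j"
  using take_add[of i "j - i" bs] assms by simp

lemma block_offset_le: "block_offset bs i \<le> sum_list bs"
  by (metis append_take_drop_id le_add1 sum_list_append)

lemma block_indices_subset: "block_indices bs i \<subseteq> {..<sum_list bs}"
  using block_offset_le[of "Suc i" bs] by (auto simp: block_indices_def)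

lemma block_indices_disjoint:
  assumes "i \<noteq> j" shows "block_indices bs i \<inter> block_indices bs j = {}"
  using assms block_offset_mono[of "Suc i" j bs] block_offset_mono[of "Suc j" i bs]
  by (cases "i < j") (auto simp: block_indices_def)

lemma block_indices_UN: "(\<Union>i<n. block_indices bs i) = {..<block_offset bs n}"
proof (induction n)
  case (Suc n)
  have "block_offset bs n \<le> block_offset bs (Suc n)" by (rule block_offset_mono) simp
  then show ?case using Suc by (auto simp: lessThan_Suc block_indices_def)
qed simp

lemma mat_block_eq:
  assumes A: "A \<in> carrier_mat (sum_list bs) (sum_list bs)" and i: "i < length bs" and j: "j < length bs"
  shows "mat_block bs A i j =
    mat (bs ! i) (bs ! j) (\<lambda>(a, b). A $$ (block_offset bs i + a, block_offset bs j + b))"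
proof -
  \<comment> \<open>\<open>submatrix\<close> cuts index sets down to the range of the matrix, which
    leaves blocks intact.\<close>
  have I: "{k. k < sum_list bs \<and> k \<in> block_indices bs l} = block_indices bs l" for l
    using block_indices_subset[of bs l] by auto
  show ?thesis
    using A i j by (intro eq_matI)
      (simp_all add: mat_block_def submatrix_def I, simp_all add: block_indices_eq pick_interval)
qed

lemma index_mat_block:
  assumes A: "A \<in> carrier_mat (sum_list bs) (sum_list bs)" and i: "i < length bs" and j: "j < length bs"
    and k: "k \<in> block_indices bs i" and l: "l \<in> block_indices bs j"
  shows "A $$ (k, l) = mat_block bs A i j $$ (k - block_offset bs i, l - block_offset bs j)"
  using k l by (auto simp: mat_block_eq[OF A i j] block_indices_eq[OF i] block_indices_eq[OF j])

text \<open>The bound on the position belongs to the claim because the induction needs it to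
  evaluate an entry of an appended vector.\<close>

lemma concat_vec_index:
  "i < length vs \<Longrightarrow> a < dim_vec (vs ! i) \<Longrightarrow>
    concat_vec vs $ (block_offset (map dim_vec vs) i + a) = vs ! i $ a \<and>
    block_offset (map dim_vec vs) i + a < dim_vec (concat_vec vs)"
proof (induction vs arbitrary: i)
  case (Cons v vs)
  have c: "concat_vec (v # vs) = v @\<^sub>v concat_vec vs" by (simp add: concat_vec_def)
  show ?case
  proof (cases i)
    case 0
    then show ?thesis using Cons.prems by (simp add: c)
  next
    case (Suc i')
    then show ?thesis using Cons.IH[of i'] Cons.prems by (simp add: c add.assoc)
  qed
qed simp

lemma dim_concat_vec: "dim_vec (concat_vec vs) = sum_list (map dim_vec vs)"
  by (induction vs) (simp_all add: concat_vec_def)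

text \<open>A set of indices without entries leading out of it can be listed last by a permutation.\<close>

lemma irreducible_mat_irreducible_on:
  assumes irr: "irreducible_mat A" and A: "A \<in> carrier_mat n n"
  shows "irreducible_on {..<n} (\<lambda>i j. A $$ (i, j))"
  unfolding irreducible_on_def
proof (intro allI impI)
  fix B assume B: "B \<subseteq> {..<n}" "B \<noteq> {}" "B \<noteq> {..<n}"
  let ?B' = "{..<n} - B"
  show "\<exists>i\<in>B. \<exists>j\<in>?B'. A $$ (i, j) \<noteq> 0"
  proof (rule ccontr)
    assume "\<not> ?thesis"
    then have closed: "A $$ (i, j) = 0" if "i \<in> B" "j \<in> ?B'" for i j using that by blast
    define r s where "r = card ?B'" and "s = card B"
    have fin: "finite B" using B finite_subset by auto
    have rs: "r + s = n" using card_Diff_subset[OF fin B(1)] card_mono[OF _ B(1)]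
      by (simp add: r_def s_def)
    have "?B' \<noteq> {}" using B by auto
    then have r1: "r \<ge> 1" by (simp add: r_def Suc_le_eq card_gt_0_iff)
    have s1: "s \<ge> 1" using B fin by (simp add: s_def Suc_le_eq card_gt_0_iff)
    obtain f where f: "bij_betw f {..<r} ?B'"
      using finite_same_card_bij[of "{..<r}" ?B'] by (auto simp: r_def)
    obtain g where g: "bij_betw g {r..<n} B"
      using finite_same_card_bij[of "{r..<n}" B] fin rs s_def by auto
    \<comment> \<open>Rows from \<open>r\<close> on come from \<open>B\<close> and columns below
      \<open>r\<close> from its complement, so closedness of \<open>B\<close> becomes the zero block
      at the lower left. Outside \<open>{..<n}\<close> a permutation of that set has to be the
      identity.\<close>
    define p where "p i = (if i < r then f i else if i < n then g i else i)" for i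
    have "bij_betw p {..<r} ?B'" using f by (rule bij_betw_cong[THEN iffD1, rotated]) (simp add: p_def)
    moreover have "bij_betw p {r..<n} B" using g by (rule bij_betw_cong[THEN iffD1, rotated]) (simp add: p_def)
    ultimately have "bij_betw p ({..<r} \<union> {r..<n}) (?B' \<union> B)" by (rule bij_betw_combine) auto
    moreover have "{..<r} \<union> {r..<n} = {..<n}" "?B' \<union> B = {..<n}" using rs B by auto
    ultimately have bij: "bij_betw p {..<n} {..<n}" by simp
    have perm: "p permutes {..<n}" by (rule bij_imp_permutes[OF bij]) (use rs in \<open>auto simp: p_def\<close>)
    have p_lt: "p i < n" if "i < n" for i using permutes_in_image[OF perm] that by simp
    have p1: "p i \<in> ?B'" if "i < r" for i using bij_betwE[OF f] that by (auto simp: p_def)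
    have p2: "p i \<in> B" if "r \<le> i" "i < n" for i using bij_betwE[OF g] that by (auto simp: p_def)
    define R :: "real mat" where "R = mat n n (\<lambda>(i, j). if i = p j then 1 else 0)"
    have R: "R \<in> carrier_mat n n" by (simp add: R_def)
    have RAR: "(transpose_mat R * A * R) $$ (i, j) = A $$ (p i, p j)" if ij: "i < n" "j < n" for i j
    proof -
      define W where "W = transpose_mat R * A"
      have W: "W \<in> carrier_mat n n" using R A by (simp add: W_def)
      have "W $$ (i, k) = A $$ (p i, k)" if k: "k < n" for k
      proof -
        have "W $$ (i, k) = (\<Sum>l\<in>{0..<n}. (if l = p i then 1 else 0) * A $$ (l, k))"
          using A ij k by (simp add: W_def R_def scalar_prod_def)
        also have "\<dots> = A $$ (p i, k)"
          using p_lt[OF ij(1)] by (simp add: if_distrib[of "\<lambda>x. x * _"] cong: if_cong)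
        finally show ?thesis .
      qed
      then have "(W * R) $$ (i, j) = (\<Sum>k\<in>{0..<n}. A $$ (p i, k) * (if k = p j then 1 else 0))"
        using W ij by (simp add: R_def scalar_prod_def)
      also have "\<dots> = A $$ (p i, p j)"
        using p_lt[OF ij(2)] by (simp add: if_distrib cong: if_cong)
      finally show ?thesis by (simp add: W_def)
    qed
    define X where "X = mat r r (\<lambda>(i, j). A $$ (p i, p j))"
    define Y where "Y = mat r s (\<lambda>(i, j). A $$ (p i, p (r + j)))"
    define Z where "Z = mat s s (\<lambda>(i, j). A $$ (p (r + i), p (r + j)))"
    have eq: "transpose_mat R * A * R = four_block_mat X Y (0\<^sub>m s r) Z"
    proof (rule eq_matI)
      fix i j assume "i < dim_row (four_block_mat X Y (0\<^sub>m s r) Z)"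
        "j < dim_col (four_block_mat X Y (0\<^sub>m s r) Z)"
      then have ij: "i < n" "j < n" using rs by (simp_all add: X_def Z_def)
      show "(transpose_mat R * A * R) $$ (i, j) = four_block_mat X Y (0\<^sub>m s r) Z $$ (i, j)"
        using ij rs closed[OF p2[of i] p1[of j]] by (auto simp: RAR X_def Y_def Z_def)
    qed (use R A rs in \<open>simp_all add: X_def Z_def\<close>)
    have "reducible_mat A"
      unfolding reducible_mat_def
    proof (intro conjI exI)
      show "permutation_mat (dim_row A) R"
        unfolding permutation_mat_def using perm A by (auto simp: R_def)
      show "transpose_mat R * A * R = four_block_mat X Y (0\<^sub>m s r) Z" by (rule eq)
    qed (use A r1 s1 rs in \<open>auto simp: X_def Y_def Z_def\<close>)
    \<comment> \<open>A nonempty proper \<open>B\<close> forces order at least 2, which excludes the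
      clause of irreducibility for order 1.\<close>
    moreover have "dim_row A \<noteq> 1" using A r1 s1 rs by auto
    ultimately show False using irr by (simp add: irreducible_mat_def)
  qed
qed

lemma nonzero_vec_index:
  assumes "w \<in> carrier_vec n" "w \<noteq> 0\<^sub>v n"
  obtains i where "i < n" "w $ i \<noteq> 0"
  using assms by (metis carrier_vecD eq_vecI index_zero_vec)

lemma vec_tendsto_pointwise:
  assumes x: "\<And>k. x k \<in> carrier_vec n" and y: "y \<in> carrier_vec n"
    and lim: "\<And>i. i < n \<Longrightarrow> (\<lambda>k. x k $ i) \<longlonglongrightarrow> y $ i"
  shows "vec_tendsto x y"
  unfolding vec_tendsto_def
proof (intro conjI allI)
  show "dim_vec (x k) = dim_vec y" for k using x[of k] y by simp
  have "norm1 (x k - y) = (\<Sum>i<n. \<bar>x k $ i - y $ i\<bar>)" for k using y by (simp add: norm1_def)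
  moreover have "(\<lambda>k. \<Sum>i<n. \<bar>x k $ i - y $ i\<bar>) \<longlonglongrightarrow> (\<Sum>i<n. \<bar>y $ i - y $ i\<bar>)"
    by (intro tendsto_intros lim) simp
  ultimately show "(\<lambda>k. norm1 (x k - y)) \<longlonglongrightarrow> 0" by simp
qed

text \<open>Block entries are entries of \<open>A\<close> shifted by the offset, so irreducibility
  moves along the shift to global indices.\<close>

lemma block_irreducible_on:
  assumes A: "A \<in> carrier_mat (sum_list bs) (sum_list bs)" and i: "i < length bs"
    and irr: "irreducible_mat (mat_block bs A i i)"
  shows "irreducible_on (block_indices bs i) (\<lambda>k l. A $$ (k, l))"
proof -
  have "irreducible_on {..<bs ! i} (\<lambda>k l. mat_block bs A i i $$ (k, l))"
    by (rule irreducible_mat_irreducible_on[OF irr]) (simp add: mat_block_eq[OF A i i])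
  then have "irreducible_on {..<bs ! i} (\<lambda>k l. A $$ (block_offset bs i + k, block_offset bs i + l))"
    by (rule irreducible_on_cong) (simp add: mat_block_eq[OF A i i])
  then show ?thesis unfolding block_indices_image[OF i] by (rule irreducible_on_image)
qed

lemma irreducible_mat_dim_pos: "irreducible_mat A \<Longrightarrow> 0 < dim_row A"
  by (auto simp: irreducible_mat_def)

section \<open>Row-stochastic matrices\<close>

lemma row_stochastic_stochastic_on:
  "A \<in> carrier_mat n n \<Longrightarrow> row_stochastic A \<longleftrightarrow> stochastic_on {..<n} (\<lambda>i j. A $$ (i, j))"
  by (auto simp: row_stochastic_def nonneg_mat_def stochastic_on_def)

lemma index_mat_of_row_mult:
  assumes "A \<in> carrier_mat n n" "v \<in> carrier_vec n" "j < n"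
  shows "(mat_of_row v * A) $$ (0, j) = (\<Sum>i<n. v $ i * A $$ (i, j))"
  using assms by (simp add: mat_of_row_def scalar_prod_def atLeast0LessThan)

lemma row_stochastic_mult_ones:
  assumes "A \<in> carrier_mat n n" "row_stochastic A"
  shows "A *\<^sub>v ones_vec n = ones_vec n"
  using assms by (intro eq_vecI) (auto simp: ones_vec_def row_stochastic_def scalar_prod_def atLeast0LessThan)

text \<open>At a coordinate where an eigenvector has its largest modulus, the row of
  \<open>A\<close> only averages, so the eigenvalue has modulus at most 1. The all-ones vector
  attains 1.\<close>

lemma spectral_radius_row_stochastic:
  assumes A: "A \<in> carrier_mat n n" and n: "0 < n" and stoch: "row_stochastic A"
  shows "spectral_radius (map_mat complex_of_real A) = 1"
proof -
  let ?A = "map_mat complex_of_real A"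
  have cA: "?A \<in> carrier_mat n n" using A by simp
  have p: "stochastic_on {..<n} (\<lambda>i j. A $$ (i, j))"
    using stoch row_stochastic_stochastic_on[OF A] by simp
  have le: "cmod k \<le> 1" if "eigenvalue ?A k" for k
  proof -
    from that obtain w where w: "w \<in> carrier_vec n" "w \<noteq> 0\<^sub>v n" "?A *\<^sub>v w = k \<cdot>\<^sub>v w"
      using A by (auto simp: eigenvalue_def eigenvector_def)
    define m where "m = Max ((\<lambda>i. cmod (w $ i)) ` {..<n})"
    have le_m: "cmod (w $ i) \<le> m" if "i < n" for i unfolding m_def using that by auto
    have "m \<in> (\<lambda>i. cmod (w $ i)) ` {..<n}" unfolding m_def using n by (intro Max_in) auto
    then obtain a where a: "a < n" "cmod (w $ a) = m" by auto
    obtain i where "i < n" "w $ i \<noteq> 0" using nonzero_vec_index[OF w(1,2)] .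
    then have m: "0 < m" using le_m[of i] by (meson less_le_trans zero_less_norm_iff)
    have "k * w $ a = (?A *\<^sub>v w) $ a" using w a by simp
    also have "\<dots> = (\<Sum>j<n. of_real (A $$ (a, j)) * w $ j)"
      using w(1) a(1) A by (simp add: scalar_prod_def atLeast0LessThan)
    finally have "cmod k * m = cmod (\<Sum>j<n. of_real (A $$ (a, j)) * w $ j)"
      using a by (metis norm_mult)
    also have "\<dots> \<le> (\<Sum>j<n. A $$ (a, j) * m)"
    proof (rule sum_norm_le)
      fix j assume j: "j \<in> {..<n}"
      then have "0 \<le> A $$ (a, j)" using stochastic_on_nonneg[OF p, of a j] a by simp
      then show "cmod (of_real (A $$ (a, j)) * w $ j) \<le> A $$ (a, j) * m"
        using le_m[of j] j by (simp add: norm_mult mult_left_mono)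
    qed
    also have "\<dots> = m" using stochastic_on_sum[OF p, of a] a by (simp flip: sum_distrib_right)
    finally show ?thesis using m by simp
  qed
  have "eigenvector ?A (vec n (\<lambda>_. 1)) 1"
    unfolding eigenvector_def
  proof (intro conjI)
    show "vec n (\<lambda>_. 1) \<noteq> (0\<^sub>v (dim_row ?A) :: complex vec)"
    proof
      assume "vec n (\<lambda>_. 1) = (0\<^sub>v (dim_row ?A) :: complex vec)"
      then have "vec n (\<lambda>_. 1) $ 0 = (0\<^sub>v (dim_row ?A) :: complex vec) $ 0" by simp
      then show False using n A by simp
    qed
    show "?A *\<^sub>v vec n (\<lambda>_. 1) = 1 \<cdot>\<^sub>v vec n (\<lambda>_. 1)"
    proof (rule eq_vecI)
      fix i assume "i < dim_vec (1 \<cdot>\<^sub>v vec n (\<lambda>_. 1) :: complex vec)"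
      then have i: "i < n" by simp
      have "(?A *\<^sub>v vec n (\<lambda>_. 1)) $ i = (\<Sum>j<n. complex_of_real (A $$ (i, j)))"
        using i A by (simp add: scalar_prod_def atLeast0LessThan)
      also have "\<dots> = of_real (\<Sum>j<n. A $$ (i, j))" by simp
      also have "\<dots> = 1" using stochastic_on_sum[OF p, of i] i by simp
      finally show "(?A *\<^sub>v vec n (\<lambda>_. 1)) $ i = (1 \<cdot>\<^sub>v vec n (\<lambda>_. 1)) $ i" using i by simp
    qed (use A in simp)
  qed (use A in simp)
  then have "1 \<in> spectrum ?A" by (auto simp: spectrum_def eigenvalue_def)
  then have "1 \<in> norm ` spectrum ?A" by (metis image_eqI norm_one)
  then have "1 \<le> spectral_radius ?A" by (rule spectral_radius_mem_max(2)[OF cA n])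
  moreover have "spectral_radius ?A \<le> 1"
    using spectral_radius_mem_max(1)[OF cA n] le by (auto simp: spectrum_def)
  ultimately show ?thesis by simp
qed

text \<open>With the spectral radius known to be 1, the Perron condition loses its reference to
  complex eigenvalues and speaks of the real kernel only.\<close>

lemma is_left_perron_vec_iff:
  assumes A: "A \<in> carrier_mat n n" and n: "0 < n" and stoch: "row_stochastic A"
  shows "is_left_perron_vec A q \<longleftrightarrow> q \<in> carrier_vec n \<and>
    invariant_on {..<n} (\<lambda>i j. A $$ (i, j)) (($) q) \<and> (\<forall>i<n. 0 < q $ i) \<and> (\<Sum>i<n. q $ i) = 1"
proof (cases "q \<in> carrier_vec n")
  case True
  have "mat_of_row q * A = mat_of_row q \<longleftrightarrow> invariant_on {..<n} (\<lambda>i j. A $$ (i, j)) (($) q)"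
  proof
    assume eq: "mat_of_row q * A = mat_of_row q"
    show "invariant_on {..<n} (\<lambda>i j. A $$ (i, j)) (($) q)"
      unfolding invariant_on_def
    proof
      fix j assume "j \<in> {..<n}"
      then have j: "j < n" by simp
      have "(\<Sum>i<n. q $ i * A $$ (i, j)) = (mat_of_row q * A) $$ (0, j)"
        by (rule index_mat_of_row_mult[OF A True j, symmetric])
      also have "\<dots> = q $ j" unfolding eq using True j by (simp add: mat_of_row_def)
      finally show "(\<Sum>i<n. q $ i * A $$ (i, j)) = q $ j" .
    qed
  next
    assume inv: "invariant_on {..<n} (\<lambda>i j. A $$ (i, j)) (($) q)"
    show "mat_of_row q * A = mat_of_row q"
    proof (rule eq_matI)
      fix i j assume "i < dim_row (mat_of_row q)" "j < dim_col (mat_of_row q)"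
      then have i: "i = 0" and j: "j < n" using True by (auto simp: mat_of_row_def)
      show "(mat_of_row q * A) $$ (i, j) = mat_of_row q $$ (i, j)"
        unfolding i index_mat_of_row_mult[OF A True j]
        using inv j True by (simp add: invariant_on_def mat_of_row_def)
    qed (use A True in \<open>auto simp: mat_of_row_def\<close>)
  qed
  moreover have "1 \<cdot>\<^sub>m mat_of_row q = mat_of_row q" by (intro eq_matI) auto
  moreover have "q \<bullet> ones_vec n = (\<Sum>i<n. q $ i)"
    using True by (simp add: scalar_prod_def ones_vec_def atLeast0LessThan)
  ultimately show ?thesis
    using True A by (simp add: is_left_perron_vec_def spectral_radius_row_stochastic[OF A n stoch] positive_vec_def)
next
  case False
  then show ?thesis using A by (simp add: is_left_perron_vec_def)
qed

text \<open>The all-ones vector shows that 1 is an eigenvalue. A matrix and its transpose share the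
  characteristic polynomial, so there is also a real left fixed vector; its absolute value is
  invariant, positive by irreducibility, and can be normalized.\<close>

lemma left_perron_vec_unique_exists:
  assumes A: "A \<in> carrier_mat n n" and n: "0 < n" and stoch: "row_stochastic A" and irr: "irreducible_mat A"
  shows "\<exists>!q. is_left_perron_vec A q"
proof (rule ex_ex1I)
  let ?S = "{..<n}" and ?p = "\<lambda>i j. A $$ (i, j)"
  have p: "stochastic_on ?S ?p" using stoch row_stochastic_stochastic_on[OF A] by simp
  have irr': "irreducible_on ?S ?p" using irreducible_mat_irreducible_on[OF irr A] .
  have AT: "transpose_mat A \<in> carrier_mat n n" using A by simp
  have "ones_vec n $ 0 \<noteq> (0\<^sub>v n :: real vec) $ 0" using n by (simp add: ones_vec_def)
  then have "ones_vec n \<noteq> 0\<^sub>v n" by metis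
  then have "eigenvector A (ones_vec n) 1"
    using A row_stochastic_mult_ones[OF A stoch]
    by (auto simp: eigenvector_def ones_vec_def intro!: eq_vecI)
  then have "eigenvalue A 1" unfolding eigenvalue_def ..
  then have "eigenvalue (transpose_mat A) 1"
    using eigenvalue_root_char_poly[OF A] eigenvalue_root_char_poly[OF AT] char_poly_transpose_mat[OF A]
    by simp
  then obtain w where w: "w \<in> carrier_vec n" "w \<noteq> 0\<^sub>v n" "transpose_mat A *\<^sub>v w = w"
    using A by (auto simp: eigenvalue_def eigenvector_def)
  have "invariant_on ?S ?p (($) w)"
    unfolding invariant_on_def
  proof
    fix j assume j: "j \<in> ?S"
    then have "w $ j = (transpose_mat A *\<^sub>v w) $ j" using w by simp
    also have "\<dots> = (\<Sum>i<n. A $$ (i, j) * w $ i)"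
      using w(1) j A by (simp add: scalar_prod_def atLeast0LessThan)
    finally show "(\<Sum>i\<in>?S. w $ i * A $$ (i, j)) = w $ j" by (simp add: mult.commute)
  qed
  then have inv: "invariant_on ?S ?p (\<lambda>i. \<bar>w $ i\<bar>)" by (intro invariant_on_abs p) auto
  obtain a where a: "a < n" "w $ a \<noteq> 0" using nonzero_vec_index[OF w(1,2)] .
  have pos: "0 < \<bar>w $ j\<bar>" if "j < n" for j
    by (rule invariant_on_pos[OF _ p irr' inv, of a j]) (use a that in auto)
  define s where "s = (\<Sum>i<n. \<bar>w $ i\<bar>)"
  have s: "0 < s" unfolding s_def by (rule sum_pos) (use pos n in auto)
  define q where "q = vec n (\<lambda>i. \<bar>w $ i\<bar> / s)"
  have "invariant_on ?S ?p (($) q)"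
    using inv by (simp add: invariant_on_def q_def flip: sum_divide_distrib)
  moreover have "(\<Sum>i<n. q $ i) = 1" using s by (simp add: q_def s_def flip: sum_divide_distrib)
  ultimately have "is_left_perron_vec A q"
    unfolding is_left_perron_vec_iff[OF A n stoch] using pos s by (simp add: q_def)
  then show "\<exists>q. is_left_perron_vec A q" ..
  fix q q' assume "is_left_perron_vec A q" "is_left_perron_vec A q'"
  then have qs: "q \<in> carrier_vec n" "invariant_on ?S ?p (($) q)" "(\<Sum>i<n. q $ i) = 1"
    "q' \<in> carrier_vec n" "invariant_on ?S ?p (($) q')" "(\<Sum>i<n. q' $ i) = 1"
    unfolding is_left_perron_vec_iff[OF A n stoch] by auto
  show "q = q'"
  proof (rule eq_vecI)
    fix i assume "i < dim_vec q'"
    then show "q $ i = q' $ i"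
      using invariant_on_unique[OF _ p irr' qs(2) qs(5), of i] qs by simp
  qed (use qs in simp)
qed

text \<open>A vector killed by I - lam P satisfies w = lam P w, so its largest modulus
  \<open>m\<close> obeys m \<le> lam m and is 0. The two orders of multiplying by the inverse yield
  the two resolvent identities.\<close>

lemma resolvent_mat_resolvent_on:
  assumes P: "P \<in> carrier_mat n n" and stoch: "row_stochastic P" and lam: "0 < lam" "lam < 1"
  shows "resolvent_mat P lam \<in> carrier_mat n n"
    "resolvent_on {..<n} (\<lambda>i j. P $$ (i, j)) lam (\<lambda>i j. resolvent_mat P lam $$ (i, j))"
proof -
  let ?K = "1\<^sub>m n - lam \<cdot>\<^sub>m P"
  have K: "?K \<in> carrier_mat n n" by (intro minus_carrier_mat smult_carrier_mat P)
  have p: "stochastic_on {..<n} (\<lambda>i j. P $$ (i, j))"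
    using stoch row_stochastic_stochastic_on[OF P] by simp
  have "det ?K \<noteq> 0"
  proof
    assume "det ?K = 0"
    then obtain w where w: "w \<in> carrier_vec n" "w \<noteq> 0\<^sub>v n" "?K *\<^sub>v w = 0\<^sub>v n"
      using det_0_iff_vec_prod_zero[OF K] by auto
    have weq: "w $ i = lam * (\<Sum>j<n. P $$ (i, j) * w $ j)" if i: "i < n" for i
    proof -
      have "0 = (?K *\<^sub>v w) $ i" using w i by simp
      also have "\<dots> = (\<Sum>j<n. (of_bool (i = j) - lam * P $$ (i, j)) * w $ j)"
        using w(1) i P by (auto simp: scalar_prod_def atLeast0LessThan intro!: sum.cong)
      also have "\<dots> = (\<Sum>j<n. of_bool (i = j) * w $ j) - lam * (\<Sum>j<n. P $$ (i, j) * w $ j)"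
        by (simp add: left_diff_distrib sum_subtractf sum_distrib_left mult.assoc)
      also have "(\<Sum>j<n. of_bool (i = j) * w $ j) = w $ i"
        using i by (simp add: of_bool_def if_distrib[of "\<lambda>x. x * _"] cong: if_cong)
      finally show ?thesis by simp
    qed
    obtain i where i: "i < n" "w $ i \<noteq> 0" using nonzero_vec_index[OF w(1,2)] .
    define m where "m = Max ((\<lambda>i. \<bar>w $ i\<bar>) ` {..<n})"
    have le_m: "\<bar>w $ i\<bar> \<le> m" if "i < n" for i unfolding m_def using that by auto
    have "m \<in> (\<lambda>i. \<bar>w $ i\<bar>) ` {..<n}" unfolding m_def using i by (intro Max_in) auto
    then obtain a where a: "a < n" "\<bar>w $ a\<bar> = m" by auto
    have m: "0 < m" using le_m[OF i(1)] i(2) by linarith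
    have "m = lam * \<bar>\<Sum>j<n. P $$ (a, j) * w $ j\<bar>"
      using weq[OF a(1)] a(2) lam by (metis abs_mult abs_of_pos)
    also have "\<dots> \<le> lam * (\<Sum>j<n. P $$ (a, j) * m)"
    proof (intro mult_left_mono order.trans[OF sum_abs] sum_mono)
      fix j assume j: "j \<in> {..<n}"
      then have "0 \<le> P $$ (a, j)" using stochastic_on_nonneg[OF p, of a j] a by simp
      then show "\<bar>P $$ (a, j) * w $ j\<bar> \<le> P $$ (a, j) * m"
        using le_m[of j] j by (simp add: abs_mult mult_left_mono)
    qed (use lam in simp)
    also have "\<dots> = lam * m" using stochastic_on_sum[OF p, of a] a by (simp flip: sum_distrib_right)
    finally show False using m lam by simp
  qed
  then have "?K \<in> Units (ring_mat TYPE(real) n ())" by (rule det_non_zero_imp_unit[OF K])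
  then obtain B where some: "mat_inverse ?K = Some B"
    using mat_inverse(1)[OF K, of "()"] by (cases "mat_inverse ?K") auto
  from mat_inverse(2)[OF K this]
  have B: "?K * B = 1\<^sub>m n" "B * ?K = 1\<^sub>m n" "B \<in> carrier_mat n n" by auto
  have X: "resolvent_mat P lam = (1 - lam) \<cdot>\<^sub>m B"
    using P some by (simp add: resolvent_mat_def)
  show "resolvent_mat P lam \<in> carrier_mat n n" using B by (simp add: X)
  show "resolvent_on {..<n} (\<lambda>i j. P $$ (i, j)) lam (\<lambda>i j. resolvent_mat P lam $$ (i, j))"
    unfolding resolvent_on_def
  proof (intro ballI conjI)
    fix i j assume ij: "i \<in> {..<n}" "j \<in> {..<n}"
    have "of_bool (i = j) = (?K * B) $$ (i, j)" using ij unfolding B by simp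
    also have "\<dots> = (\<Sum>k<n. (of_bool (i = k) - lam * P $$ (i, k)) * B $$ (k, j))"
      using ij P B(3) by (auto simp: scalar_prod_def atLeast0LessThan intro!: sum.cong)
    also have "\<dots> = (\<Sum>k<n. of_bool (i = k) * B $$ (k, j)) - lam * (\<Sum>k<n. P $$ (i, k) * B $$ (k, j))"
      by (simp add: left_diff_distrib sum_subtractf sum_distrib_left mult.assoc)
    also have "(\<Sum>k<n. of_bool (i = k) * B $$ (k, j)) = B $$ (i, j)"
      using ij by (simp add: of_bool_def if_distrib[of "\<lambda>x. x * _"] cong: if_cong)
    finally have b: "B $$ (i, j) = of_bool (i = j) + lam * (\<Sum>k<n. P $$ (i, k) * B $$ (k, j))" by simp
    have "resolvent_mat P lam $$ (i, j) = (1 - lam) * B $$ (i, j)" using ij B(3) by (simp add: X)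
    also have "\<dots> = (1 - lam) * of_bool (i = j) + lam * (\<Sum>k<n. P $$ (i, k) * ((1 - lam) * B $$ (k, j)))"
      by (subst b) (simp add: distrib_left sum_distrib_left mult_ac)
    also have "(\<Sum>k<n. P $$ (i, k) * ((1 - lam) * B $$ (k, j))) =
        (\<Sum>k<n. P $$ (i, k) * resolvent_mat P lam $$ (k, j))"
      using ij B(3) by (simp add: X)
    finally show "resolvent_mat P lam $$ (i, j) = (1 - lam) * of_bool (i = j) +
      lam * (\<Sum>k<n. P $$ (i, k) * resolvent_mat P lam $$ (k, j))" .
    have "of_bool (i = j) = (B * ?K) $$ (i, j)" using ij unfolding B by simp
    also have "\<dots> = (\<Sum>k<n. B $$ (i, k) * (of_bool (k = j) - lam * P $$ (k, j)))"
      using ij P B(3) by (auto simp: scalar_prod_def atLeast0LessThan intro!: sum.cong)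
    also have "\<dots> = (\<Sum>k<n. B $$ (i, k) * of_bool (k = j)) - lam * (\<Sum>k<n. B $$ (i, k) * P $$ (k, j))"
      by (simp add: right_diff_distrib sum_subtractf sum_distrib_left mult_ac)
    also have "(\<Sum>k<n. B $$ (i, k) * of_bool (k = j)) = B $$ (i, j)"
      using ij by (simp add: of_bool_def if_distrib cong: if_cong)
    finally have b: "B $$ (i, j) = of_bool (i = j) + lam * (\<Sum>k<n. B $$ (i, k) * P $$ (k, j))" by simp
    have "resolvent_mat P lam $$ (i, j) = (1 - lam) * B $$ (i, j)" using ij B(3) by (simp add: X)
    also have "\<dots> = (1 - lam) * of_bool (i = j) + lam * (\<Sum>k<n. ((1 - lam) * B $$ (i, k)) * P $$ (k, j))"
      by (subst b) (simp add: distrib_left sum_distrib_left mult_ac)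
    also have "(\<Sum>k<n. ((1 - lam) * B $$ (i, k)) * P $$ (k, j)) =
        (\<Sum>k<n. resolvent_mat P lam $$ (i, k) * P $$ (k, j))"
      using ij B(3) by (simp add: X)
    finally show "resolvent_mat P lam $$ (i, j) = (1 - lam) * of_bool (i = j) +
      lam * (\<Sum>k<n. resolvent_mat P lam $$ (i, k) * P $$ (k, j))" .
  qed
qed

lemma row_normalization_stochastic:
  assumes A: "A \<in> carrier_mat n n" "nonneg_mat A" and nz: "\<And>i. i < n \<Longrightarrow> row A i \<noteq> 0\<^sub>v n"
  shows "row_stochastic (row_normalization A)"
proof -
  have "(\<Sum>k<n. A $$ (i, k)) \<noteq> 0" if i: "i < n" for i
  proof
    assume "(\<Sum>k<n. A $$ (i, k)) = 0"
    then have "\<forall>k\<in>{..<n}. A $$ (i, k) = 0"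
      by (subst (asm) sum_nonneg_eq_0_iff) (use A i in \<open>auto simp: nonneg_mat_def\<close>)
    then have "row A i = 0\<^sub>v n" using A i by (intro eq_vecI) auto
    then show False using nz[OF i] by simp
  qed
  then show ?thesis
    using A by (auto simp: row_stochastic_def row_normalization_def nonneg_mat_def
      intro!: divide_nonneg_nonneg sum_nonneg simp flip: sum_divide_distrib)
qed

section \<open>The reduced form\<close>

theorem theorem6:
  fixes A P X :: "real mat" and N L M :: nat and ns ms :: "nat list"
    and Q :: "nat \<Rightarrow> nat \<Rightarrow> real mat" and D :: "nat \<Rightarrow> real mat"
    and lam :: real and v :: "real vec" and x :: "nat \<Rightarrow> real vec"
  assumes A: "A \<in> carrier_mat N N" "nonneg_mat A" "reducible_mat A"
    and no_zero_row: "\<And>i. i < N \<Longrightarrow> row A i \<noteq> 0\<^sub>v N"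
    and P: "P = row_normalization A"
    and L: "L \<ge> 1" and M: "M \<ge> 1"
    and sizes: "length ns = L" "length ms = M" "sum_list (ns @ ms) = N"
    and reduced_form: "\<And>i j. i < L + M \<Longrightarrow> j < L + M \<Longrightarrow>
          mat_block (ns @ ms) P i j =
            (if i < L \<and> i \<le> j then Q i j
             else if i \<ge> L \<and> i = j then D (i - L)
             else 0\<^sub>m ((ns @ ms) ! i) ((ns @ ms) ! j))"
    and Q_diag: "\<And>i. i < L \<Longrightarrow> irreducible_mat (Q i i) \<or> Q i i = 0\<^sub>m 1 1"
    and non_dangling: "\<And>i. i < L \<Longrightarrow>
          \<exists>j. i < j \<and> j < L + M \<and> Q i j \<noteq> 0\<^sub>m ((ns @ ms) ! i) ((ns @ ms) ! j)"
    and D_irreducible: "\<And>j. j < M \<Longrightarrow> irreducible_mat (D j)"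
    and lam: "0 < lam" "lam < 1"
    and X: "X = resolvent_mat P lam"
    and v: "personalization_vec N v" "norm1 v = 1"
    and x_0: "x 0 = v"
    and x_Suc: "\<And>k. k \<ge> 1 \<Longrightarrow> mat_of_row (x k) = mat_of_row (x (k - 1)) * X"
  shows "(\<forall>k \<ge> 1. mat_of_row (x k) = mat_of_row v * X ^\<^sub>m k) \<and>
    (\<forall>j < M. row_stochastic (D j) \<and> (\<exists>!q. is_left_perron_vec (D j) q)) \<and>
    (\<exists>\<alpha> :: nat \<Rightarrow> real. (\<forall>j < M. \<alpha> j \<ge> 0) \<and> (\<Sum>j < M. \<alpha> j) = 1 \<and>
       vec_tendsto x
         (concat_vec (map 0\<^sub>v ns @ map (\<lambda>j. \<alpha> j \<cdot>\<^sub>v left_perron_vec (D j)) [0..<M])))"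
proof -
  define bs where "bs = ns @ ms"
  define p where "p i j = P $$ (i, j)" for i j
  define r where "r i j = X $$ (i, j)" for i j
  define S where "S = {..<N}"
  \<comment> \<open>The non-dangling blocks come first, so their union is an initial
    segment.\<close>
  define T where "T = {..<block_offset bs L}"
  define C where "C j = block_indices bs (L + j)" for j
  have len: "length bs = L + M" and sum_bs: "sum_list bs = N"
    using sizes by (simp_all add: bs_def)
  note form = reduced_form[folded bs_def]
  have Pc: "P \<in> carrier_mat N N" using A(1) by (simp add: P row_normalization_def)
  then have Pc': "P \<in> carrier_mat (sum_list bs) (sum_list bs)" by (simp add: sum_bs)
  have P_stoch: "row_stochastic P" unfolding P by (rule row_normalization_stochastic[OF A(1,2) no_zero_row])
  have finS: "finite S" by (simp add: S_def)
  have p: "stochastic_on S p"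
    using P_stoch row_stochastic_stochastic_on[OF Pc] by (simp add: S_def p_def[abs_def])
  have Xc: "X \<in> carrier_mat N N" and res: "resolvent_on S p lam r"
    using resolvent_mat_resolvent_on[OF Pc P_stoch lam] by (simp_all add: X S_def p_def[abs_def] r_def[abs_def])
  have r: "stochastic_on S r" by (rule resolvent_stochastic[OF finS p lam res])

  \<comment> \<open>Partition of the indices into non-dangling ones and dangling clusters\<close>
  have blockS: "block_indices bs i \<subseteq> S" for i
    using block_indices_subset[of bs i] by (simp add: S_def sum_bs)
  have T_UN: "T = (\<Union>i<L. block_indices bs i)" by (simp add: T_def block_indices_UN)
  have S_blocks: "S = (\<Union>i<L + M. block_indices bs i)"
    using len by (simp add: S_def block_indices_UN flip: sum_bs)
  also have "{..<L + M} = {..<L} \<union> (\<lambda>j. L + j) ` {..<M}"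
    unfolding lessThan_atLeast0 image_add_atLeastLessThan by auto
  finally have S_UN: "S = T \<union> (\<Union>j<M. C j)" by (simp add: T_UN C_def)
  have block_T: "block_indices bs i \<inter> T = {}" if "L \<le> i" for i
  proof -
    have "block_indices bs i \<inter> block_indices bs l = {}" if "l < L" for l
      using \<open>L \<le> i\<close> that by (intro block_indices_disjoint) simp
    then show ?thesis unfolding T_UN by blast
  qed
  have C_T: "C j \<inter> T = {}" for j unfolding C_def by (rule block_T) simp
  have C_disj: "C j \<inter> C l = {}" if "j \<noteq> l" for j l
    unfolding C_def using that by (intro block_indices_disjoint) simp
  have TS: "T \<subseteq> S" and CS: "C j \<subseteq> S" for j using S_UN blockS by (auto simp: C_def)
  have p_block: "p k l = mat_block bs P i j $$ (k - block_offset bs i, l - block_offset bs j)"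
    if "i < L + M" "j < L + M" "k \<in> block_indices bs i" "l \<in> block_indices bs j" for i j k l
    unfolding p_def using index_mat_block[OF Pc', of i j k l] that len by simp

  \<comment> \<open>The dangling clusters as closed irreducible classes\<close>
  have D_block: "mat_block bs P (L + j) (L + j) = D j" if "j < M" for j
    using form[of "L + j" "L + j"] that by simp
  have Dc: "D j \<in> carrier_mat (ms ! j) (ms ! j)" if "j < M" for j
    using that len sizes(1) mat_block_eq[OF Pc', of "L + j" "L + j"]
    by (simp add: D_block) (simp add: bs_def nth_append)
  have ms_pos: "0 < ms ! j" if "j < M" for j
    using irreducible_mat_dim_pos[OF D_irreducible[OF that]] Dc[OF that] by simp
  have C_image: "C j = (\<lambda>a. block_offset bs (L + j) + a) ` {..<ms ! j}" if "j < M" for j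
    using block_indices_image[of "L + j" bs] that len sizes(1) by (simp add: C_def bs_def nth_append)
  have D_entry: "D j $$ (a, b) = p (block_offset bs (L + j) + a) (block_offset bs (L + j) + b)"
    if "j < M" "a < ms ! j" "b < ms ! j" for j a b
    using p_block[of "L + j" "L + j"] that D_block[of j] C_image[of j] by (auto simp: C_def)
  have C_closed: "p i k = 0" if j: "j < M" and i: "i \<in> C j" and k: "k \<in> S - C j" for i j k
  proof -
    from k obtain l where l: "l < L + M" "k \<in> block_indices bs l"
      using S_blocks by auto
    then have ne: "l \<noteq> L + j" using k by (auto simp: C_def)
    \<comment> \<open>These bounds place the local position inside the zero block, where
      \<open>0\<^sub>m\<close> evaluates to 0.\<close>
    have "k - block_offset bs l < bs ! l" "i - block_offset bs (L + j) < bs ! (L + j)"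
      using l i j len by (auto simp: C_def block_indices_eq)
    then show ?thesis
      using p_block[of "L + j" l i k] form[of "L + j" l] l i j ne by (simp add: C_def)
  qed
  have pC: "stochastic_on (C j) p" if "j < M" for j
    by (rule stochastic_on_closed[OF finS CS p C_closed[OF that]])
  have irrC: "irreducible_on (C j) p" if "j < M" for j
    using block_irreducible_on[OF Pc', of "L + j"] D_irreducible[OF that] D_block[OF that] len that
    by (simp add: C_def p_def[abs_def])
  have D_stoch: "row_stochastic (D j)" if j: "j < M" for j
  proof -
    have "stochastic_on {..<ms ! j}
        (\<lambda>a b. p (block_offset bs (L + j) + a) (block_offset bs (L + j) + b))"
      using pC[OF j] unfolding C_image[OF j] by (subst (asm) stochastic_on_image) auto
    then show ?thesis
      unfolding row_stochastic_stochastic_on[OF Dc[OF j]]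
      by (simp add: stochastic_on_def D_entry[OF j])
  qed
  \<comment> \<open>Existence and uniqueness together give the definite description
    \<open>left_perron_vec\<close> its meaning.\<close>
  have perron: "\<exists>!q. is_left_perron_vec (D j) q" if "j < M" for j
    by (rule left_perron_vec_unique_exists[OF Dc ms_pos D_stoch D_irreducible]) (rule that)+
  have finC: "finite (C j)" for j using finite_subset[OF CS finS] .
  have resC: "resolvent_on (C j) p lam r" if "j < M" for j
    by (rule resolvent_on_closed[OF finS p lam res CS C_closed[OF that]])
  have rC: "stochastic_on (C j) r" if "j < M" for j
    by (rule resolvent_stochastic[OF finC pC[OF that] lam resC[OF that]])
  have r_pos: "0 < r i k" if "j < M" "i \<in> C j" "k \<in> C j" for i j k
    by (rule resolvent_pos[OF finC pC[OF that(1)] lam resC[OF that(1)] irrC[OF that(1)] that(2,3)])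
  have r_zero: "r i k = 0" if "j < M" "i \<in> C j" "k \<in> S - C j" for i j k
    by (rule resolvent_closed_zero[OF finS p lam res CS C_closed[OF that(1)] that(2,3)])

  \<comment> \<open>Escape from the non-dangling indices\<close>
  have exit: "\<exists>i\<in>E. \<exists>k\<in>S - E. p i k \<noteq> 0" if E: "E \<subseteq> T" "E \<noteq> {}" for E
  proof -
    define I where "I = {b. b < L \<and> block_indices bs b \<inter> E \<noteq> {}}"
    define b where "b = Max I"
    have "finite I" "I \<noteq> {}" using E by (auto simp: I_def T_UN)
    then have "b \<in> I" and b_max: "\<And>b'. b' \<in> I \<Longrightarrow> b' \<le> b" by (auto simp: b_def)
    then have b: "b < L" "block_indices bs b \<inter> E \<noteq> {}" by (auto simp: I_def)
    have Qb: "mat_block bs P b j = Q b j" if "b \<le> j" "j < L + M" for j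
      using form[of b j] b that by simp
    show ?thesis
    proof (cases "block_indices bs b \<subseteq> E")
      case True
      obtain j where j: "b < j" "j < L + M" "Q b j \<noteq> 0\<^sub>m (bs ! b) (bs ! j)"
        using non_dangling[OF b(1), folded bs_def] by blast
      have Q: "Q b j = mat (bs ! b) (bs ! j) (\<lambda>(a, c). p (block_offset bs b + a) (block_offset bs j + c))"
        using Qb[of j] mat_block_eq[OF Pc', of b j] b j len by (simp add: p_def)
      have "\<exists>a<bs ! b. \<exists>c<bs ! j. Q b j $$ (a, c) \<noteq> 0"
      proof (rule ccontr)
        assume "\<not> ?thesis"
        then have "Q b j = 0\<^sub>m (bs ! b) (bs ! j)" by (intro eq_matI) (auto simp: Q)
        then show False using j by simp
      qed
      then obtain a c where ac: "a < bs ! b" "c < bs ! j" "Q b j $$ (a, c) \<noteq> 0" by blast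
      have mem: "block_offset bs b + a \<in> block_indices bs b" "block_offset bs j + c \<in> block_indices bs j"
        using ac b j len by (auto simp: block_indices_eq)
      \<comment> \<open>Among the blocks to the right of \<open>b\<close>, those below
        \<open>L\<close> are missed by maximality of \<open>b\<close>, the others because
        \<open>E\<close> lies in \<open>T\<close>.\<close>
      have "block_indices bs j \<inter> E = {}"
      proof (cases "j < L")
        case True
        then show ?thesis using b_max[of j] j(1) by (auto simp: I_def)
      next
        case False
        then show ?thesis using block_T[of j] E by auto
      qed
      then have "block_offset bs j + c \<in> S - E" using mem blockS by blast
      moreover have "block_offset bs b + a \<in> E" using mem True by blast
      moreover have "p (block_offset bs b + a) (block_offset bs j + c) \<noteq> 0" using ac by (simp add: Q)
      ultimately show ?thesis by blast
    next
      case False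
      \<comment> \<open>A null block of order 1 is a single index; being met by \<open>E\<close> it
        would be contained in \<open>E\<close>.\<close>
      have "irreducible_mat (Q b b)"
      proof (rule ccontr)
        assume "\<not> irreducible_mat (Q b b)"
        then have "dim_row (mat_block bs P b b) = 1" using Q_diag[OF b(1)] Qb[of b] b by simp
        then have "bs ! b = 1" using mat_block_eq[OF Pc', of b b] b len by simp
        then have "block_indices bs b = {block_offset bs b}" using b len by (auto simp: block_indices_eq)
        then show False using False b by auto
      qed
      then have "irreducible_on (block_indices bs b) p"
        using block_irreducible_on[OF Pc', of b] Qb[of b] b len by (simp add: p_def[abs_def])
      moreover have "block_indices bs b \<inter> E \<noteq> block_indices bs b" using False by blast
      ultimately obtain i k where "i \<in> block_indices bs b \<inter> E"
        "k \<in> block_indices bs b - block_indices bs b \<inter> E" "p i k \<noteq> 0"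
        unfolding irreducible_on_def using b(2) by (meson inf_le1)
      then show ?thesis using blockS[of b] by blast
    qed
  qed
  have leak: "\<exists>j\<in>S - T. r i j \<noteq> 0" if "i \<in> T" for i
    by (rule resolvent_leak[OF finS p lam res TS exit that])
  have no_return: "r i k = 0" if ik: "i \<in> S - T" "k \<in> T" for i k
  proof -
    obtain j where j: "j < M" "i \<in> C j" using ik S_UN by auto
    then show ?thesis using r_zero[OF j] ik C_T[of j] TS by auto
  qed
  have inflow: "r i k = 0" if j: "j < M" and ik: "i \<in> S - C j - T" "k \<in> C j" for i j k
  proof -
    obtain l where l: "l < M" "i \<in> C l" using ik S_UN by auto
    then have "l \<noteq> j" using ik by auto
    then show ?thesis using r_zero[OF l] ik C_disj[of l j] CS[of j] by auto
  qed

  \<comment> \<open>The sequence as a chain driven by X\<close>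
  have vc: "v \<in> carrier_vec N" and v_nn: "\<And>i. i < N \<Longrightarrow> 0 \<le> v $ i"
    using v by (auto simp: personalization_vec_def positive_vec_def less_imp_le)
  have v_sum: "(\<Sum>i\<in>S. v $ i) = 1"
    using v by (simp add: personalization_vec_def scalar_prod_def ones_vec_def S_def atLeast0LessThan)
  have xc: "x k \<in> carrier_vec N" for k
  \<comment> \<open>The recursion equates row matrices, so the dimension of \<open>x k\<close> is
    read off their column counts.\<close>
  proof (cases k)
    case (Suc k')
    have "dim_col (mat_of_row (x k)) = dim_col (mat_of_row (x k') * X)" using x_Suc[of k] Suc by simp
    then have "dim_vec (x k) = N" using carrier_matD(2)[OF Xc] by (simp add: mat_of_row_def)
    then show ?thesis by (rule carrier_vecI)
  qed (simp add: x_0 vc)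
  have x_step: "x (Suc k) $ j = (\<Sum>i\<in>S. x k $ i * r i j)" if "j \<in> S" for k j
  proof -
    have "x (Suc k) $ j = mat_of_row (x (Suc k)) $$ (0, j)"
      using that xc[of "Suc k"] by (simp add: mat_of_row_def S_def)
    also have "\<dots> = (mat_of_row (x k) * X) $$ (0, j)" using x_Suc[of "Suc k"] by simp
    also have "\<dots> = (\<Sum>i\<in>S. x k $ i * r i j)"
      using index_mat_of_row_mult[OF Xc xc[of k], of j] that by (simp add: S_def r_def)
    finally show ?thesis .
  qed
  have x0_nn: "0 \<le> x 0 $ i" if "i \<in> S" for i using v_nn that by (simp add: x_0 S_def)
  have T_lim: "(\<lambda>k. x k $ i) \<longlonglongrightarrow> 0" if "i \<in> T" for i
    by (rule chain_transient_tendsto_0[OF finS TS r no_return leak x_step x0_nn that])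

  \<comment> \<open>Perron vectors, weights and the limit vector\<close>
  define q where "q j = left_perron_vec (D j)" for j
  have "is_left_perron_vec (D j) (q j)" if "j < M" for j
    unfolding q_def left_perron_vec_def by (rule theI'[OF perron[OF that]])
  then have q: "q j \<in> carrier_vec (ms ! j)"
    "invariant_on {..<ms ! j} (\<lambda>a b. D j $$ (a, b)) (($) (q j))"
    "\<forall>a<ms ! j. 0 < q j $ a" "(\<Sum>a<ms ! j. q j $ a) = 1" if "j < M" for j
    using is_left_perron_vec_iff[OF Dc ms_pos D_stoch, of j "q j"] that by auto
  \<comment> \<open>The Perron vector moved to global indices; on \<open>C j\<close> the subtraction
    never truncates.\<close>
  define c where "c j i = q j $ (i - block_offset bs (L + j))" for i j
  have c: "invariant_on (C j) r (c j)" "\<And>i. i \<in> C j \<Longrightarrow> 0 \<le> c j i" "(\<Sum>i\<in>C j. c j i) = 1"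
    if j: "j < M" for j
  proof -
    have "invariant_on (C j) p (c j)"
      unfolding C_image[OF j]
      by (subst invariant_on_image) (use q(2)[OF j] in \<open>simp_all add: invariant_on_def c_def D_entry[OF j]\<close>)
    then show "invariant_on (C j) r (c j)"
      by (rule resolvent_invariant[OF finC pC[OF j] lam resC[OF j]])
    show "\<And>i. i \<in> C j \<Longrightarrow> 0 \<le> c j i"
      unfolding C_image[OF j] using q(3)[OF j] by (auto simp: c_def less_imp_le)
    show "(\<Sum>i\<in>C j. c j i) = 1"
      unfolding C_image[OF j] using q(4)[OF j] by (simp add: sum.reindex c_def)
  qed
  have "\<exists>a. 0 \<le> a \<and> (\<forall>i\<in>C j. (\<lambda>k. x k $ i) \<longlonglongrightarrow> a * c j i)" if j: "j < M" for j
  proof -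
    have sub: "C j \<subseteq> S - T" using CS[of j] C_T[of j] by blast
    have ne: "C j \<noteq> {}" using C_image[OF j] ms_pos[OF j] by auto
    show ?thesis
      by (rule chain_closed_class_limit[OF finS TS sub ne r no_return leak rC[OF j] r_pos[OF j]
            inflow[OF j] c[OF j] x_step x0_nn]) blast+
  qed
  then obtain \<alpha> where "\<forall>j<M. 0 \<le> \<alpha> j \<and> (\<forall>i\<in>C j. (\<lambda>k. x k $ i) \<longlonglongrightarrow> \<alpha> j * c j i)"
    by metis
  then have \<alpha>: "0 \<le> \<alpha> j" "i \<in> C j \<Longrightarrow> (\<lambda>k. x k $ i) \<longlonglongrightarrow> \<alpha> j * c j i" if "j < M" for i j
    using that by blast+
  define vs where "vs = map 0\<^sub>v ns @ map (\<lambda>j. \<alpha> j \<cdot>\<^sub>v q j) [0..<M]"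
  define y where "y = concat_vec vs"
  \<comment> \<open>The pieces of the limit have exactly the block sizes, so the offsets of
    \<open>P\<close> also address its entries.\<close>
  have vs_dims: "map dim_vec vs = bs"
    unfolding vs_def bs_def using sizes q(1) by (auto intro!: nth_equalityI simp: nth_append)
  have yc: "y \<in> carrier_vec N"
    by (rule carrier_vecI) (simp add: y_def dim_concat_vec vs_dims sum_bs)
  have y_entry: "y $ (block_offset bs l + a) = vs ! l $ a" if "l < L + M" "a < bs ! l" for l a
  proof -
    have "l < length vs" using that len vs_dims by (metis length_map)
    moreover have "dim_vec (vs ! l) = bs ! l" using calculation vs_dims by (metis nth_map)
    ultimately show ?thesis using concat_vec_index[of l vs a] that by (simp add: y_def vs_dims)
  qed
  have y_T: "y $ i = 0" if i: "i \<in> T" for i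
  proof -
    obtain l where l: "l < L" "i \<in> block_indices bs l" using i T_UN by auto
    then obtain a where a: "i = block_offset bs l + a" "a < bs ! l"
      using block_indices_image[of l bs] len by auto
    then show ?thesis using y_entry[of l a] l sizes by (simp add: vs_def nth_append bs_def)
  qed
  have y_C: "y $ i = \<alpha> j * c j i" if j: "j < M" and i: "i \<in> C j" for i j
  proof -
    obtain a where a: "i = block_offset bs (L + j) + a" "a < ms ! j"
      using i C_image[OF j] by auto
    moreover have "bs ! (L + j) = ms ! j" using sizes by (simp add: bs_def nth_append)
    moreover have "vs ! (L + j) = \<alpha> j \<cdot>\<^sub>v q j" using sizes j by (simp add: vs_def nth_append)
    ultimately show ?thesis using y_entry[of "L + j" a] q(1)[OF j] j by (simp add: c_def)
  qed
  have lim: "(\<lambda>k. x k $ i) \<longlonglongrightarrow> y $ i" if i: "i \<in> S" for i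
  proof (cases "i \<in> T")
    case True
    then show ?thesis using T_lim y_T by simp
  next
    case False
    then obtain j where "j < M" "i \<in> C j" using i S_UN by auto
    then show ?thesis using \<alpha>(2) y_C by simp
  qed
  \<comment> \<open>The weights sum to 1 because the chain conserves the total mass 1 of
    \<open>v\<close>, a finite sum passes to the limit, and \<open>T\<close> carries none of the
    limit mass.\<close>
  have "(\<Sum>i\<in>S. x k $ i) = 1" for k
    using chain_nonneg_sum(2)[of S r "\<lambda>k. ($) (x k)", OF r x_step x0_nn] v_sum by (simp add: x_0)
  moreover have "(\<lambda>k. \<Sum>i\<in>S. x k $ i) \<longlonglongrightarrow> (\<Sum>i\<in>S. y $ i)" by (intro tendsto_sum lim)
  ultimately have y_sum: "(\<Sum>i\<in>S. y $ i) = 1" by (simp add: LIMSEQ_const_iff)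
  have "(\<Sum>i\<in>S. y $ i) = (\<Sum>i\<in>(\<Union>j<M. C j). y $ i)"
    by (rule sum.mono_neutral_right) (use finS S_UN y_T in auto)
  also have "\<dots> = (\<Sum>j<M. \<Sum>i\<in>C j. y $ i)"
    by (rule sum.UNION_disjoint) (use finC C_disj in auto)
  also have "\<dots> = (\<Sum>j<M. \<alpha> j)"
    by (rule sum.cong) (simp_all add: y_C c(3) flip: sum_distrib_left)
  finally have \<alpha>_sum: "(\<Sum>j<M. \<alpha> j) = 1" using y_sum by simp
  have conv: "vec_tendsto x y" by (rule vec_tendsto_pointwise[OF xc yc]) (simp add: lim S_def)

  \<comment> \<open>The closed form through powers of X\<close>
  have rowv: "mat_of_row v \<in> carrier_mat 1 N" using vc by (simp add: mat_of_row_def)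
  have powers: "mat_of_row (x k) = mat_of_row v * X ^\<^sub>m k" for k
  proof (induction k)
    case 0
    show ?case using right_mult_one_mat[OF rowv] Xc by (simp add: x_0)
  next
    case (Suc k)
    have "mat_of_row (x (Suc k)) = mat_of_row v * X ^\<^sub>m k * X" using x_Suc[of "Suc k"] Suc by simp
    also have "\<dots> = mat_of_row v * X ^\<^sub>m Suc k"
      using assoc_mult_mat[OF rowv pow_carrier_mat[OF Xc] Xc] by simp
    finally show ?case .
  qed
  show ?thesis
    using powers D_stoch perron \<alpha>(1) \<alpha>_sum conv by (auto simp: y_def vs_def q_def)
qed

end
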